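(* Fix $p\in(0,1]$. For each $\ell\geq 1$, choose a lattice path $\nu^{(\ell)}$ consisting of a total of $\ell$ north and east steps. Let $n_\ell$ be the number of north steps in $\nu^{(\ell)}$, and assume that the limit $\overline n=\lim_{\ell\to\infty}\frac{1}{\ell}n_\ell$ exists. Then, as $\ell\to\infty$, \[\mathcal E(\mathrm{Tam}(\nu^{(\ell)}))\leq\frac{1}{p}\left(1+2\sqrt{(1-p)\overline n(1-\overline n)}\right)\ell+o(\ell).\]
   Context: A lattice path is a finite path of unit north (N) and east (E) steps between integer points (up to translation). For a lattice path $\nu$ from $(0,0)$ to $(\ell-n,n)$, $\mathrm{Tam}(\nu)$ is the set of lattice paths with the same endpoints lying weakly above $\nu$. For a lattice point $v=(x,y)$ weakly above $\nu$ with $0\le x\le \ell-n$, $0\le y\le n$, its horizontal distance is the largest $d$ such that $(x+d,y)$ lies on $\nu$. If $\mu\in\mathrm{Tam}(\nu)$ and $v$ is a lattice point of $\mu$ immediately preceded by an E step and immediately followed by an N step, let $v'$ be the first lattice point of $\mu$ after $v$ with the same horizontal distance as $v$, let $\mathrm D$ be the subpath of $\mu$ from $v$ to $v'$, write $\mu=\mathrm X\,\mathrm E\,\mathrm D\,\mathrm Y$, and set $\mu'=\mathrm X\,\mathrm D\,\mathrm E\,\mathrm Y$; declare $\mu\lessdot\mu'$. These cover relations generate a partial order making $\mathrm{Tam}(\nu)$ a lattice (the $\nu$-Tamari lattice). For a finite lattice $L$, the Ungarian Markov chain (probability $p$) moves from $x$ to $\bigwedge(\{x\}\cup T)$, where $T$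 contains each element covered by $x$ independently with probability $p$; $\mathcal E(L)$ is the expected number of steps from the top element to the bottom element. *)

theory Defs
  imports
    "HOL-Probability.Probability"
    "HOL-Algebra.Lattice"
    "HOL-Library.Landau_Symbols"
begin

section \<open>Lattice paths and \<open>\<nu>\<close>-Tamari lattices\<close>

datatype step = North | East

text \<open>A list of steps stands for the lattice path that starts at the origin.\<close>

definition endpoint :: "step list \<Rightarrow> nat \<times> nat" where
  "endpoint \<mu> = (count_list \<mu> East, count_list \<mu> North)"

definition lattice_points :: "step list \<Rightarrow> (nat \<times> nat) set" where
  "lattice_points \<mu> = {endpoint (take k \<mu>) | k. k \<le> length \<mu>}"

definition point_above :: "step list \<Rightarrow> nat \<times> nat \<Rightarrow> bool" where
  "point_above \<nu> v \<longleftrightarrow> (\<exists>y'\<le>snd v. (fst v, y') \<in> lattice_points \<nu>)"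

definition Tam_paths :: "step list \<Rightarrow> step list set" where
  "Tam_paths \<nu> = {\<mu>. endpoint \<mu> = endpoint \<nu> \<and> (\<forall>v\<in>lattice_points \<mu>. point_above \<nu> v)}"

text \<open>The greatest \<open>d\<close> exists whenever \<open>v\<close> is weakly above \<open>\<nu>\<close> and not higher than its
  endpoint; elsewhere the value is unspecified.\<close>

definition horiz_dist :: "step list \<Rightarrow> nat \<times> nat \<Rightarrow> nat" where
  "horiz_dist \<nu> v = (GREATEST d. (fst v + d, snd v) \<in> lattice_points \<nu>)"

text \<open>In the decomposition \<open>\<mu> = X E D Y\<close>, the point \<open>v\<close> is the endpoint of \<open>X E\<close>, the points
  of \<open>\<mu>\<close> strictly after \<open>v\<close> and up to \<open>v'\<close> are the endpoints of \<open>X E\<close> followed by a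
  nonempty prefix of \<open>D\<close>, and the first step of \<open>D\<close> is the north step following \<open>v\<close>.\<close>

definition Tam_cover :: "step list \<Rightarrow> step list \<Rightarrow> step list \<Rightarrow> bool" where
  "Tam_cover \<nu> \<mu> \<mu>' \<longleftrightarrow> \<mu> \<in> Tam_paths \<nu> \<and>
     (\<exists>X D Y. \<mu> = X @ [East] @ D @ Y \<and> \<mu>' = X @ D @ [East] @ Y \<and>
        D \<noteq> [] \<and> hd D = North \<and>
        horiz_dist \<nu> (endpoint (X @ [East] @ D)) = horiz_dist \<nu> (endpoint (X @ [East])) \<and>
        (\<forall>k. 0 < k \<and> k < length D \<longrightarrow>
           horiz_dist \<nu> (endpoint (X @ [East] @ take k D)) \<noteq> horiz_dist \<nu> (endpoint (X @ [East]))))"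

definition Tam :: "step list \<Rightarrow> step list gorder" where
  "Tam \<nu> = \<lparr>carrier = Tam_paths \<nu>, eq = (=), le = (Tam_cover \<nu>)\<^sup>*\<^sup>*\<rparr>"

section \<open>Ungarian Markov chains\<close>

definition lower_covers :: "'a gorder \<Rightarrow> 'a \<Rightarrow> 'a set" where
  "lower_covers L x = {y \<in> carrier L. y \<sqsubset>\<^bsub>L\<^esub> x \<and>
     \<not> (\<exists>z\<in>carrier L. y \<sqsubset>\<^bsub>L\<^esub> z \<and> z \<sqsubset>\<^bsub>L\<^esub> x)}"

definition random_subset :: "real \<Rightarrow> 'a set \<Rightarrow> 'a set pmf" where
  "random_subset p A = map_pmf (\<lambda>f. {a \<in> A. f a}) (Pi_pmf A False (\<lambda>_. bernoulli_pmf p))"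

definition ungarian_kernel :: "real \<Rightarrow> 'a gorder \<Rightarrow> 'a \<Rightarrow> 'a pmf" where
  "ungarian_kernel p L x =
     map_pmf (\<lambda>T. \<Sqinter>\<^bsub>L\<^esub>(insert x T)) (random_subset p (lower_covers L x))"

text \<open>The Markov chain on a finite state space \<open>S\<close> with transition kernel \<open>K\<close> is realised by
  i.i.d. random self-maps: at every time \<open>k\<close> a map \<open>\<omega> k\<close> is drawn whose value at each
  \<open>x \<in> S\<close> is distributed as \<open>K x\<close>, and the chain moves from \<open>x\<close> to \<open>\<omega> k x\<close>.\<close>

definition chain_space :: "'a set \<Rightarrow> ('a \<Rightarrow> 'a pmf) \<Rightarrow> (nat \<Rightarrow> 'a \<Rightarrow> 'a) measure" where
  "chain_space S K = Pi\<^sub>M UNIV (\<lambda>_. measure_pmf (Pi_pmf S undefined K))"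

primrec chain_state :: "'a \<Rightarrow> (nat \<Rightarrow> 'a \<Rightarrow> 'a) \<Rightarrow> nat \<Rightarrow> 'a" where
  "chain_state x \<omega> 0 = x"
| "chain_state x \<omega> (Suc k) = \<omega> k (chain_state x \<omega> k)"

text \<open>The infimum is \<open>\<infinity>\<close> if the state \<open>y\<close> is never visited.\<close>

definition hitting_time :: "'a \<Rightarrow> 'a \<Rightarrow> (nat \<Rightarrow> 'a \<Rightarrow> 'a) \<Rightarrow> ennreal" where
  "hitting_time x y \<omega> = (INF k\<in>{k. chain_state x \<omega> k = y}. of_nat k)"

definition ungarian_expected_steps :: "real \<Rightarrow> 'a gorder \<Rightarrow> ennreal" where
  "ungarian_expected_steps p L =
     (\<integral>\<^sup>+ \<omega>. hitting_time \<top>\<^bsub>L\<^esub> \<bottom>\<^bsub>L\<^esub> \<omega> \<partial>chain_space (carrier L) (ungarian_kernel p L))"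

end

theory Submission
  imports Defs
begin

text \<open>
  A path above \<open>\<nu>\<close> is encoded by its \<open>\<nu>\<close>-bracket vector, which turns the \<open>\<nu>\<close>-Tamari order into the
  componentwise order and meets into componentwise minima. The elements on chains of maximal length
  form a distributive sublattice, the spine; they are the order ideals of a set of cells in the
  \<open>m \<times> n\<close> rectangle with the product order. If \<open>s\<close> is the least spine element above a path \<open>x\<close>,
  then each maximal cell of \<open>s\<close> can be removed by one particular lower cover of \<open>x\<close>, and distinct
  cells use distinct covers. Hence the expected last-passage time through \<open>s\<close> with geometric weights
  drops in mean by at least one in every step of the Ungarian chain, and its value on the full
  rectangle bounds the expected number of steps.

  The last-passage time is in turn bounded by its stationary version: with independent geometric
  increments of parameters \<open>\<alpha>\<close> and \<open>\<beta>\<close> on the two axes, where \<open>(1 - \<alpha>) (1 - \<beta>) = 1 - p\<close>, the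
  increments along every down-right path have the same law, which gives the bound
  \<open>m / \<alpha> + n / \<beta>\<close>. Its minimum is \<open>(m + n + 2 sqrt ((1 - p) m n)) / p\<close>.
\<close>

text \<open>The Ungarian chain leaves the spine, and the ideal attached to its state need not evolve
  as a Markov chain, so the comparison uses a supermartingale. If the chain moved on the spine, each
  maximal cell would disappear independently with probability \<open>p\<close> per step. A cell
  would then wait a geometric time once everything above it is gone, and the emptying time would be
  the largest weight of a chain of cells. At a general state other lower covers may be chosen too;
  they only shrink the ideal, and passage times are monotone in it, so the drift inequality
  survives. Nonnegative boundary increments can only raise a passage time, and their invariant law
  makes the mean computable for all finite \<open>m\<close> and \<open>n\<close>. The constant is
  the known limit shape of geometric last-passage percolation, so the rectangle bound is sharp to
  leading order. The \<open>o(l)\<close> term comes only from replacing the proportion of north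
  steps by its limit.\<close>

instance step :: countable by countable_datatype

section \<open>A drift bound for expected hitting times\<close>

text \<open>The minimum of \<open>N\<close> and the hitting time, unrolled from the first step: the
  remaining maps are again distributed as \<open>chain_space\<close>, which turns one-step analysis
  into an induction on \<open>N\<close>.\<close>

primrec hit_upto :: "'a \<Rightarrow> nat \<Rightarrow> 'a \<Rightarrow> (nat \<Rightarrow> 'a \<Rightarrow> 'a) \<Rightarrow> ennreal" where
  "hit_upto y 0 x \<omega> = 0"
| "hit_upto y (Suc N) x \<omega> = (if x = y then 0 else 1 + hit_upto y N (\<omega> 0 x) (\<lambda>k. \<omega> (Suc k)))"

lemma hit_upto_eq_card:
  "hit_upto y N x \<omega> = of_nat (card {k. k < N \<and> (\<forall>j\<le>k. chain_state x \<omega> j \<noteq> y)})"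
proof (induction N arbitrary: x \<omega>)
  case (Suc N)
  have st: "chain_state x \<omega> (Suc j) = chain_state (\<omega> 0 x) (\<lambda>k. \<omega> (Suc k)) j" for j
    by (induction j) auto
  show ?case
  proof (cases "x = y")
    case True
    then have e: "{k. k < Suc N \<and> (\<forall>j\<le>k. chain_state x \<omega> j \<noteq> y)} = {}"
      by (auto intro: exI[of _ 0])
    show ?thesis unfolding e using True by simp
  next
    case False
    let ?A = "{k. k < N \<and> (\<forall>j\<le>k. chain_state (\<omega> 0 x) (\<lambda>k. \<omega> (Suc k)) j \<noteq> y)}"
    have e: "{k. k < Suc N \<and> (\<forall>j\<le>k. chain_state x \<omega> j \<noteq> y)} = insert 0 (Suc ` ?A)"
    proof (intro Set.set_eqI)
      fix k
      have *: "(\<forall>j\<le>Suc k. chain_state x \<omega> j \<noteq> y) \<longleftrightarrow>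
          (\<forall>j\<le>k. chain_state (\<omega> 0 x) (\<lambda>k. \<omega> (Suc k)) j \<noteq> y)" for k
        using False by (metis chain_state.simps(1) Suc_le_mono not0_implies_Suc st zero_le)
      show "k \<in> {k. k < Suc N \<and> (\<forall>j\<le>k. chain_state x \<omega> j \<noteq> y)} \<longleftrightarrow> k \<in> insert 0 (Suc ` ?A)"
        by (cases k) (use False in \<open>auto simp: * simp del: chain_state.simps(2)\<close>)
    qed
    have "card (insert 0 (Suc ` ?A)) = Suc (card ?A)"
      by (subst card_insert_disjoint) (auto simp: card_image)
    then show ?thesis
      unfolding e using False Suc[of "\<omega> 0 x" "\<lambda>k. \<omega> (Suc k)"] by simp
  qed
qed simp

lemma SUP_hit_upto: "(SUP N. hit_upto y N x \<omega>) = hitting_time x y \<omega>"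
proof (cases "\<exists>k. chain_state x \<omega> k = y")
  case True
  define m where "m = (LEAST k. chain_state x \<omega> k = y)"
  have m: "chain_state x \<omega> m = y" unfolding m_def using True by (rule LeastI_ex)
  have less: "chain_state x \<omega> j \<noteq> y" if "j < m" for j
    using that unfolding m_def by (rule not_less_Least)
  have set: "{k. k < N \<and> (\<forall>j\<le>k. chain_state x \<omega> j \<noteq> y)} = {..<min N m}" for N
    using m less by (auto simp: not_less[symmetric])
  have 1: "hitting_time x y \<omega> = of_nat m"
    unfolding hitting_time_def
  proof (rule antisym)
    show "(INF k\<in>{k. chain_state x \<omega> k = y}. of_nat k) \<le> (of_nat m :: ennreal)"
      by (rule INF_lower) (simp add: m)
    show "of_nat m \<le> (INF k\<in>{k. chain_state x \<omega> k = y}. of_nat k :: ennreal)"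
      by (rule INF_greatest) (use less not_less in \<open>auto simp del: of_nat_le_iff intro!: of_nat_mono\<close>)
  qed
  have 2: "(SUP N. of_nat (min N m) :: ennreal) = of_nat m"
  proof (rule antisym)
    show "(SUP N. of_nat (min N m) :: ennreal) \<le> of_nat m" by (rule SUP_least) (auto intro!: of_nat_mono)
    show "of_nat m \<le> (SUP N. of_nat (min N m) :: ennreal)" by (rule SUP_upper2[of m]) auto
  qed
  show ?thesis unfolding hit_upto_eq_card set 1 by (simp add: 2)
next
  case False
  then have 1: "hitting_time x y \<omega> = \<infinity>" unfolding hitting_time_def by simp
  have set: "{k. k < N \<and> (\<forall>j\<le>k. chain_state x \<omega> j \<noteq> y)} = {..<N}" for N using False by auto
  show ?thesis unfolding hit_upto_eq_card set 1 by (simp add: ennreal_SUP_of_nat_eq_top)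
qed

lemma incseq_hit_upto: "incseq (\<lambda>N. hit_upto y N x)"
  unfolding hit_upto_eq_card
  by (intro monoI le_funI of_nat_mono card_mono) auto

text \<open>Countability of the state space enters here: the state after one step is random, and
  measurability is known for each fixed value of it.\<close>

lemma hit_upto_measurable [measurable]:
  fixes K :: "'a :: countable \<Rightarrow> 'a pmf"
  shows "hit_upto y N x \<in> borel_measurable (chain_space S K)"
proof (induction N arbitrary: x)
  case (Suc N)
  have shift: "(\<lambda>\<omega> k. \<omega> (Suc k)) \<in> chain_space S K \<rightarrow>\<^sub>M chain_space S K"
    unfolding chain_space_def
    by (rule measurable_PiM_single') (auto simp: space_PiM)
  have "(\<lambda>\<omega>. \<omega> 0 x) \<in> chain_space S K \<rightarrow>\<^sub>M count_space UNIV"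
    unfolding chain_space_def
    by (rule measurable_compose[OF measurable_component_singleton]) auto
  then have "(\<lambda>\<omega>. hit_upto y N (\<omega> 0 x) (\<lambda>k. \<omega> (Suc k))) \<in> borel_measurable (chain_space S K)"
    by (rule measurable_compose_countable[rotated]) (rule measurable_compose[OF shift Suc])
  then show ?case by (cases "x = y") simp_all
next
  case 0
  have "hit_upto y 0 x = (\<lambda>_. 0)" by (simp add: fun_eq_iff)
  then show ?case by simp
qed

text \<open>One-step analysis with a Lyapunov function \<open>V\<close>; truncation at
  \<open>N\<close> replaces an optional stopping argument.\<close>

lemma nn_integral_hit_upto_le:
  fixes K :: "'a :: countable \<Rightarrow> 'a pmf" and V :: "'a \<Rightarrow> ennreal"
  assumes S: "finite S" "\<And>x. x \<in> S \<Longrightarrow> set_pmf (K x) \<subseteq> S"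
    and drift: "\<And>x. x \<in> S \<Longrightarrow> x \<noteq> y \<Longrightarrow> 1 + (\<integral>\<^sup>+z. V z \<partial>K x) \<le> V x"
    and x: "x \<in> S"
  shows "(\<integral>\<^sup>+\<omega>. hit_upto y N x \<omega> \<partial>chain_space S K) \<le> V x"
  using x
proof (induction N arbitrary: x)
  case (Suc N)
  let ?M = "measure_pmf (Pi_pmf S undefined K)"
  let ?C = "chain_space S K"
  interpret M: prob_space ?M by (rule measure_pmf.prob_space_axioms)
  interpret C: sequence_space ?M by unfold_locales
  interpret Cp: prob_space ?C unfolding chain_space_def by (rule C.prob_space_axioms)
  show ?case
  proof (cases "x = y")
    case False
    \<comment> \<open>The product measure is the image, under \<open>case_nat\<close>, of the first
      map paired with an independent copy of the whole sequence.\<close>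
    have shift: "(\<lambda>(s, \<omega>). case_nat s \<omega>) \<in> ?M \<Otimes>\<^sub>M ?C \<rightarrow>\<^sub>M ?C"
      unfolding chain_space_def by measurable
    have "(\<integral>\<^sup>+\<omega>. hit_upto y (Suc N) x \<omega> \<partial>?C) =
        (\<integral>\<^sup>+\<omega>. hit_upto y (Suc N) x \<omega> \<partial>distr (?M \<Otimes>\<^sub>M ?C) ?C (\<lambda>(s, \<omega>). case_nat s \<omega>))"
      using C.PiM_iter unfolding chain_space_def by simp
    also have "\<dots> = (\<integral>\<^sup>+z. hit_upto y (Suc N) x (case z of (s, \<omega>) \<Rightarrow> case_nat s \<omega>) \<partial>(?M \<Otimes>\<^sub>M ?C))"
      by (rule nn_integral_distr[OF shift]) (simp only: measurable_distr_eq1 hit_upto_measurable)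
    also have "\<dots> = (\<integral>\<^sup>+s. \<integral>\<^sup>+\<omega>. hit_upto y (Suc N) x (case_nat s \<omega>) \<partial>?C \<partial>?M)"
      by (subst Cp.nn_integral_fst[symmetric]) 
        (auto intro!: measurable_compose[OF shift] hit_upto_measurable simp del: hit_upto.simps)
    also have "\<dots> = (\<integral>\<^sup>+s. 1 + (\<integral>\<^sup>+\<omega>. hit_upto y N (s x) \<omega> \<partial>?C) \<partial>?M)"
    proof (rule nn_integral_cong)
      fix s
      have "(\<integral>\<^sup>+\<omega>. hit_upto y (Suc N) x (case_nat s \<omega>) \<partial>?C) = (\<integral>\<^sup>+\<omega>. 1 + hit_upto y N (s x) \<omega> \<partial>?C)"
        using False by (intro nn_integral_cong) simp
      also have "\<dots> = 1 + (\<integral>\<^sup>+\<omega>. hit_upto y N (s x) \<omega> \<partial>?C)"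
        by (subst nn_integral_add) (auto simp: Cp.emeasure_space_1)
      finally show "(\<integral>\<^sup>+\<omega>. hit_upto y (Suc N) x (case_nat s \<omega>) \<partial>?C) = \<dots>" .
    qed
    also have "\<dots> = (\<integral>\<^sup>+z. 1 + (\<integral>\<^sup>+\<omega>. hit_upto y N z \<omega> \<partial>?C) \<partial>map_pmf (\<lambda>s. s x) (Pi_pmf S undefined K))"
      by (rule nn_integral_map_pmf[symmetric])
    also have "\<dots> = (\<integral>\<^sup>+z. 1 + (\<integral>\<^sup>+\<omega>. hit_upto y N z \<omega> \<partial>?C) \<partial>K x)"
      using Suc.prems S by (simp only: Pi_pmf_component if_True)
    also have "\<dots> \<le> (\<integral>\<^sup>+z. 1 + V z \<partial>K x)"
      using S(2)[OF Suc.prems] by (intro nn_integral_mono_AE) (auto simp: AE_measure_pmf_iff intro!: add_left_mono Suc.IH)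
    also have "\<dots> = 1 + (\<integral>\<^sup>+z. V z \<partial>K x)" by (subst nn_integral_add) (auto simp: measure_pmf.emeasure_space_1)
    also have "\<dots> \<le> V x" using drift Suc.prems False by blast
    finally show ?thesis .
  qed simp
next
  case 0
  have "hit_upto y 0 x = (\<lambda>_. 0)" by (simp add: fun_eq_iff)
  then show ?case by simp
qed

lemma expected_hitting_time_le:
  fixes K :: "'a :: countable \<Rightarrow> 'a pmf" and V :: "'a \<Rightarrow> ennreal"
  assumes "finite S" "\<And>x. x \<in> S \<Longrightarrow> set_pmf (K x) \<subseteq> S"
    and "\<And>x. x \<in> S \<Longrightarrow> x \<noteq> y \<Longrightarrow> 1 + (\<integral>\<^sup>+z. V z \<partial>K x) \<le> V x"
    and "x \<in> S"
  shows "(\<integral>\<^sup>+\<omega>. hitting_time x y \<omega> \<partial>chain_space S K) \<le> V x"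
proof -
  have "(\<integral>\<^sup>+\<omega>. hitting_time x y \<omega> \<partial>chain_space S K) = (SUP N. \<integral>\<^sup>+\<omega>. hit_upto y N x \<omega> \<partial>chain_space S K)"
    unfolding SUP_hit_upto[symmetric] using incseq_hit_upto[of y x]
    by (intro nn_integral_monotone_convergence_SUP) auto
  also have "\<dots> \<le> V x"
    by (intro SUP_least nn_integral_hit_upto_le[OF assms])
  finally show ?thesis .
qed

section \<open>Last-passage percolation\<close>

text \<open>The number of trials including the first success, whereas \<open>geometric_pmf\<close>
  counts failures only: removing a cell takes at least one step.\<close>

definition geometric1_pmf :: "real \<Rightarrow> nat pmf" where
  "geometric1_pmf p = map_pmf Suc (geometric_pmf p)"

text \<open>Memorylessness: the first trial is revealed, and after a failure a fresh copy of the
  waiting time remains.\<close>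

lemma geometric1_unfold:
  assumes "p \<in> {0<..1}"
  shows "geometric1_pmf p = do {b \<leftarrow> bernoulli_pmf p; g \<leftarrow> geometric1_pmf p; return_pmf (if b then 1 else Suc g)}"
proof -
  have "geometric1_pmf p = do {b \<leftarrow> bernoulli_pmf p; if b then return_pmf 1 else map_pmf Suc (geometric1_pmf p)}"
    unfolding geometric1_pmf_def by (subst geometric_bind_pmf_unfold[OF assms]) (auto simp: map_bind_pmf intro!: bind_pmf_cong)
  also have "\<dots> = do {b \<leftarrow> bernoulli_pmf p; g \<leftarrow> geometric1_pmf p; return_pmf (if b then 1 else Suc g)}"
    by (intro bind_pmf_cong) (auto simp: map_pmf_def)
  finally show ?thesis .
qed

lemma nn_integral_geometric1:
  assumes "p \<in> {0<..1}"
  shows "(\<integral>\<^sup>+x. of_nat x \<partial>geometric1_pmf p) = ennreal (1 / p)"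
proof -
  have "(\<integral>\<^sup>+x. of_nat x \<partial>geometric1_pmf p) = (\<integral>\<^sup>+x. 1 + of_nat x \<partial>geometric_pmf p)"
    unfolding geometric1_pmf_def by (simp add: add.commute)
  also have "\<dots> = 1 + (\<integral>\<^sup>+x. of_nat x \<partial>geometric_pmf p)"
    by (subst nn_integral_add) (auto simp: measure_pmf.emeasure_space_1)
  also have "(\<integral>\<^sup>+x. of_nat x \<partial>geometric_pmf p) = ennreal ((1 - p) / p)"
    using nn_integral_neg_binomial_pmf_real[OF assms, of "Suc 0"] by simp
  also have "1 + ennreal ((1 - p) / p) = ennreal (1 + (1 - p) / p)"
    using assms by (subst ennreal_plus) auto
  also have "1 + (1 - p) / p = 1 / p" using assms by (simp add: field_simps)
  finally show ?thesis .
qed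

definition cell_le :: "nat \<times> nat \<Rightarrow> nat \<times> nat \<Rightarrow> bool" where
  "cell_le a b \<longleftrightarrow> fst a \<le> fst b \<and> snd a \<le> snd b"

definition cell_chain :: "(nat \<times> nat) set \<Rightarrow> bool" where
  "cell_chain K \<longleftrightarrow> (\<forall>a\<in>K. \<forall>b\<in>K. cell_le a b \<or> cell_le b a)"

text \<open>Arbitrary chains replace connected up-right paths, so that the notion applies to any set
  of cells; as weights are nonnegative, skipping cells gains nothing.\<close>

definition passage_time :: "(nat \<times> nat) set \<Rightarrow> (nat \<times> nat \<Rightarrow> nat) \<Rightarrow> nat" where
  "passage_time s w = Max (sum w ` {K. K \<subseteq> s \<and> cell_chain K})"

lemma passage_time_le_iff: "finite s \<Longrightarrow> passage_time s w \<le> b \<longleftrightarrow> (\<forall>K. K \<subseteq> s \<longrightarrow> cell_chain K \<longrightarrow> sum w K \<le> b)"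
proof -
  assume "finite s"
  moreover have "{} \<in> {K. K \<subseteq> s \<and> cell_chain K}" by (auto simp: cell_chain_def)
  ultimately show ?thesis unfolding passage_time_def by (subst Max_le_iff) auto
qed

lemma passage_time_ge: "finite s \<Longrightarrow> K \<subseteq> s \<Longrightarrow> cell_chain K \<Longrightarrow> sum w K \<le> passage_time s w"
  using passage_time_le_iff by blast

lemma passage_time_mono: "finite t \<Longrightarrow> s \<subseteq> t \<Longrightarrow> passage_time s w \<le> passage_time t w"
  by (subst passage_time_le_iff) (auto intro: passage_time_ge finite_subset)

text \<open>Comparable cells are ordered by their coordinate sum, so a cell with the largest sum is
  on top.\<close>

lemma cell_chain_has_top:
  assumes "finite K" "K \<noteq> {}" "cell_chain K"
  shows "\<exists>t\<in>K. \<forall>a\<in>K. cell_le a t"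
proof -
  let ?f = "\<lambda>a. fst a + snd a"
  have "Max (?f ` K) \<in> ?f ` K" using assms(1,2) by (intro Max_in) auto
  then obtain t where t: "t \<in> K" "?f t = Max (?f ` K)" by auto
  have "cell_le a t" if a: "a \<in> K" for a
  proof -
    have "?f a \<le> ?f t" unfolding t(2) using assms(1) a by (intro Max_ge) auto
    moreover have "cell_le a t \<or> cell_le t a" using assms(3) a t(1) unfolding cell_chain_def by blast
    ultimately show ?thesis unfolding cell_le_def by linarith
  qed
  with t show ?thesis by blast
qed

text \<open>Every maximal chain meets \<open>C\<close>, so removing \<open>T\<close> and decrementing the rest of \<open>C\<close> shortens
  the passage time by at least one.\<close>

lemma passage_time_remove_corners:
  assumes s: "finite s" "s \<noteq> {}" and C: "C \<subseteq> s" "\<And>a. a \<in> s \<Longrightarrow> \<exists>c\<in>C. cell_le a c"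
    and w: "\<And>c. c \<in> C \<Longrightarrow> 1 \<le> w c" "\<And>c. c \<in> C - T \<Longrightarrow> g c + 1 \<le> w c"
      "\<And>c. c \<in> s - C \<Longrightarrow> g c \<le> w c"
    and T: "T \<subseteq> C"
  shows "1 + passage_time (s - T) g \<le> passage_time s w"
proof -
  have main: "sum g K + 1 \<le> passage_time s w" if K: "K \<subseteq> s - T" "cell_chain K" for K
  proof -
    have fK: "finite K" using K s finite_subset by blast
    have gw: "g a \<le> w a" if "a \<in> K" for a
    proof (cases "a \<in> C")
      case True
      with that K have "a \<in> C - T" by blast
      from w(2)[OF this] show ?thesis by simp
    next
      case False
      with that K have "a \<in> s - C" by blast
      then show ?thesis by (rule w(3))
    qed
    show ?thesis
    proof (cases "K \<inter> C = {}")
      \<comment> \<open>The cell \<open>c\<close> survived the removal, so its weight was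
        decremented.\<close>
      case False
      then obtain c where c: "c \<in> K" "c \<in> C" by blast
      have "sum g K + 1 = g c + 1 + sum g (K - {c})" using c fK by (simp add: sum.remove)
      also have "\<dots> \<le> w c + sum w (K - {c})"
        using c K w(2)[of c] gw by (intro add_mono sum_mono) auto
      also have "\<dots> = sum w K" using c fK by (simp add: sum.remove)
      also have "\<dots> \<le> passage_time s w" using K s by (intro passage_time_ge) auto
      finally show ?thesis .
    next
      \<comment> \<open>A chain missing \<open>C\<close> extends by a cell of \<open>C\<close> above
        its top, which has weight at least one.\<close>
      case True
      obtain c where c: "c \<in> C" "\<forall>a\<in>K. cell_le a c"
      proof (cases "K = {}")
        case True
        with s C show ?thesis using that by blast
      next
        case False
        with cell_chain_has_top[OF fK _ K(2)] obtain t where "t \<in> K" "\<forall>a\<in>K. cell_le a t" by blast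
        moreover obtain c where "c \<in> C" "cell_le t c" using C K \<open>t \<in> K\<close> by blast
        ultimately show ?thesis using that[of c] unfolding cell_le_def by (meson le_trans)
      qed
      have "sum g K + 1 \<le> sum w K + w c"
        using gw w(1)[OF c(1)] by (intro add_mono sum_mono) auto
      also have "\<dots> = sum w (insert c K)" using True c fK by (subst sum.insert) auto
      also have "\<dots> \<le> passage_time s w"
        using K s c C by (intro passage_time_ge) (auto simp: cell_chain_def cell_le_def)
      finally show ?thesis .
    qed
  qed
  \<comment> \<open>The empty chain shows below that the passage time is positive, so the truncated
    subtraction loses nothing.\<close>
  have "sum g K \<le> passage_time s w - 1" if "K \<subseteq> s - T" "cell_chain K" for K
    using main[OF that] by linarith
  then have "passage_time (s - T) g \<le> passage_time s w - 1" using s by (subst passage_time_le_iff) auto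
  moreover have "1 \<le> passage_time s w" using main[of "{}"] by (simp add: cell_chain_def)
  ultimately show ?thesis by linarith
qed

text \<open>The weights live on a fixed \<open>R\<close> containing \<open>s\<close>, so that all
  ideals met by the chain share one probability space.\<close>

definition mean_passage_time :: "real \<Rightarrow> (nat \<times> nat) set \<Rightarrow> (nat \<times> nat) set \<Rightarrow> ennreal" where
  "mean_passage_time p R s = (\<integral>\<^sup>+w. of_nat (passage_time s w) \<partial>Pi_pmf R 0 (\<lambda>_. geometric1_pmf p))"

lemma mean_passage_time_mono: "finite R \<Longrightarrow> t \<subseteq> R \<Longrightarrow> s \<subseteq> t \<Longrightarrow> mean_passage_time p R s \<le> mean_passage_time p R t"
  unfolding mean_passage_time_def by (intro nn_integral_mono of_nat_mono passage_time_mono) (auto intro: finite_subset)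

lemma random_subset_eq:
  assumes "finite R" "C \<subseteq> R"
  shows "random_subset p C = map_pmf (\<lambda>f. {a\<in>C. f a}) (Pi_pmf R False (\<lambda>_. bernoulli_pmf p))"
  unfolding random_subset_def Pi_pmf_subset[OF assms]
  by (auto simp: pmf.map_comp o_def intro!: pmf.map_cong)

text \<open>Unfold the weight of each corner into a coin and a fresh weight. A success means that
  the cell goes now, a failure that one unit of its weight is used up; pointwise, the passage time
  then falls by at least one.\<close>

lemma mean_passage_time_drift:
  assumes R: "finite R" "s \<subseteq> R" and s: "s \<noteq> {}"
    and C: "C \<subseteq> s" "\<And>a. a \<in> s \<Longrightarrow> \<exists>c\<in>C. cell_le a c" and p: "p \<in> {0<..1}"
  shows "1 + (\<integral>\<^sup>+T. mean_passage_time p R (s - T) \<partial>random_subset p C) \<le> mean_passage_time p R s"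
proof -
  let ?B = "Pi_pmf R False (\<lambda>_. bernoulli_pmf p)"
  let ?G = "Pi_pmf R 0 (\<lambda>_. geometric1_pmf p)"
  define \<phi> where "\<phi> f g x = (if x \<in> C then if f x then 1 else Suc (g x) else g x)"
    for f :: "nat \<times> nat \<Rightarrow> bool" and g x
  define \<psi> where "\<psi> f g x = (if x \<in> R then \<phi> f g x else 0)"
    for f :: "nat \<times> nat \<Rightarrow> bool" and g x
  \<comment> \<open>Off \<open>C\<close> the coin is drawn and discarded, so that one form covers
    all cells.\<close>
  have 1: "geometric1_pmf p = do {b \<leftarrow> bernoulli_pmf p; g \<leftarrow> geometric1_pmf p; return_pmf (if x \<in> C then if b then 1 else Suc g else g)}"
    for x
    by (cases "x \<in> C") (simp_all add: geometric1_unfold[OF p, symmetric] bind_return_pmf')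
  have "?G = Pi_pmf R 0 (\<lambda>x. do {b \<leftarrow> bernoulli_pmf p; g \<leftarrow> geometric1_pmf p; return_pmf (if x \<in> C then if b then 1 else Suc g else g)})"
    by (rule Pi_pmf_cong) (auto intro: 1)
  also have "\<dots> = do {f \<leftarrow> ?B; g \<leftarrow> ?G; return_pmf (\<psi> f g)}"
    unfolding \<psi>_def \<phi>_def
    by (simp add: Pi_pmf_bind[OF R(1), where d' = False] Pi_pmf_bind[OF R(1), where d' = 0] R(1))
  finally have 2: "?G = do {f \<leftarrow> ?B; g \<leftarrow> ?G; return_pmf (\<psi> f g)}" .
  have "1 + (\<integral>\<^sup>+T. mean_passage_time p R (s - T) \<partial>random_subset p C)
      = 1 + (\<integral>\<^sup>+f. \<integral>\<^sup>+g. of_nat (passage_time (s - {a\<in>C. f a}) g) \<partial>?G \<partial>?B)"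
    using C R by (simp add: random_subset_eq[OF R(1)] mean_passage_time_def)
  also have "\<dots> = (\<integral>\<^sup>+f. 1 + \<integral>\<^sup>+g. of_nat (passage_time (s - {a\<in>C. f a}) g) \<partial>?G \<partial>?B)"
    by (subst nn_integral_add) (auto simp: measure_pmf.emeasure_space_1)
  also have "\<dots> = (\<integral>\<^sup>+f. \<integral>\<^sup>+g. 1 + of_nat (passage_time (s - {a\<in>C. f a}) g) \<partial>?G \<partial>?B)"
    by (subst nn_integral_add) (auto simp: measure_pmf.emeasure_space_1)
  also have "\<dots> \<le> (\<integral>\<^sup>+f. \<integral>\<^sup>+g. of_nat (passage_time s (\<psi> f g)) \<partial>?G \<partial>?B)"
  proof (intro nn_integral_mono)
    fix f g
    have "1 + passage_time (s - {a\<in>C. f a}) g \<le> passage_time s (\<psi> f g)"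
      using R C by (intro passage_time_remove_corners[where C = C])
        (auto simp: \<psi>_def \<phi>_def s intro: finite_subset)
    then show "1 + of_nat (passage_time (s - {a\<in>C. f a}) g) \<le> (of_nat (passage_time s (\<psi> f g)) :: ennreal)"
      by (metis of_nat_1 of_nat_add of_nat_mono)
  qed
  also have "\<dots> = (\<integral>\<^sup>+w. of_nat (passage_time s w) \<partial>measure_pmf (do {f \<leftarrow> ?B; g \<leftarrow> ?G; return_pmf (\<psi> f g)}))"
    by simp
  also have "\<dots> = mean_passage_time p R s"
    unfolding mean_passage_time_def 2[symmetric] ..
  finally show ?thesis .
qed

section \<open>The stationary bound\<close>

text \<open>For \<open>y \<le> x\<close>, each \<open>j\<close> leaves one preimage,
  \<open>i = j + (x - y)\<close> and \<open>w = y\<close>. The sum over \<open>j\<close> is a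
  geometric series of ratio \<open>(1 - \<alpha>) * (1 - \<beta>) = 1 - p\<close>, and its value
  cancels the factor \<open>p\<close>.\<close>

lemma geometric_pair_aux:
  assumes p: "p \<in> {0<..1}" and \<alpha>: "\<alpha> \<in> {0<..1}" and \<beta>: "\<beta> \<in> {0<..1}"
    and eq: "(1 - \<alpha>) * (1 - \<beta>) = 1 - p" and xy: "y \<le> x"
  shows "pmf (do {j \<leftarrow> geometric_pmf \<beta>;
      map_pmf (\<lambda>(i, w). (w + (i - j), w + (j - i))) (pair_pmf (geometric_pmf \<alpha>) (geometric_pmf p))}) (x, y)
    = pmf (geometric_pmf \<alpha>) x * pmf (geometric_pmf \<beta>) y"
proof -
  let ?A = "geometric_pmf \<alpha>" and ?B = "geometric_pmf \<beta>" and ?W = "geometric_pmf p"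
  let ?f = "\<lambda>j (i, w). (w + (i - j), w + (j - i)) :: nat \<times> nat"
  have inner: "pmf (map_pmf (?f j) (pair_pmf ?A ?W)) (x, y) = pmf ?A (j + (x - y)) * pmf ?W y" for j
  proof -
    have "?f j -` {(x, y)} = {(j + (x - y), y)}" using xy by auto
    then show ?thesis by (simp add: pmf_map measure_pmf_single pmf_pair)
  qed
  have "ennreal (pmf (do {j \<leftarrow> ?B; map_pmf (?f j) (pair_pmf ?A ?W)}) (x, y))
      = (\<integral>\<^sup>+j. ennreal (pmf ?A (j + (x - y)) * pmf ?W y) \<partial>?B)"
    by (simp add: ennreal_pmf_bind inner)
  also have "\<dots> = (\<Sum>j. ennreal (pmf ?B j * (pmf ?A (j + (x - y)) * pmf ?W y)))"
    by (simp add: nn_integral_measure_pmf nn_integral_count_space_nat ennreal_mult)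
  also have "\<dots> = ennreal (\<beta> * \<alpha> * p * (1 - \<alpha>) ^ (x - y) * (1 - p) ^ y * (1 / (1 - (1 - p))))"
  proof (rule suminf_ennreal_eq)
    have "(\<lambda>j. \<beta> * \<alpha> * p * (1 - \<alpha>) ^ (x - y) * (1 - p) ^ y * (1 - p) ^ j) sums
        (\<beta> * \<alpha> * p * (1 - \<alpha>) ^ (x - y) * (1 - p) ^ y * (1 / (1 - (1 - p))))"
      using p by (intro sums_mult geometric_sums) auto
    also have "(\<lambda>j. \<beta> * \<alpha> * p * (1 - \<alpha>) ^ (x - y) * (1 - p) ^ y * (1 - p) ^ j) =
        (\<lambda>j. pmf ?B j * (pmf ?A (j + (x - y)) * pmf ?W y))"
      using p \<alpha> \<beta> by (auto simp: fun_eq_iff power_add power_mult_distrib eq[symmetric])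
    finally show "(\<lambda>j. pmf ?B j * (pmf ?A (j + (x - y)) * pmf ?W y)) sums
        (\<beta> * \<alpha> * p * (1 - \<alpha>) ^ (x - y) * (1 - p) ^ y * (1 / (1 - (1 - p))))" .
  qed (use p \<alpha> \<beta> in auto)
  also have "\<beta> * \<alpha> * p * (1 - \<alpha>) ^ (x - y) * (1 - p) ^ y * (1 / (1 - (1 - p))) = pmf ?A x * pmf ?B y"
  proof -
    have "(1 - \<alpha>) ^ x = (1 - \<alpha>) ^ (x - y) * (1 - \<alpha>) ^ y" using xy by (simp flip: power_add)
    moreover have "(1 - p) ^ y = (1 - \<alpha>) ^ y * (1 - \<beta>) ^ y"
      by (simp add: eq[symmetric] power_mult_distrib)
    ultimately show ?thesis using p \<alpha> \<beta> by simp
  qed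
  finally show ?thesis by simp
qed

text \<open>The minimum and the difference of two independent geometric variables are independent, and
  here the minimum is distributed as \<open>w\<close>: the update merely resamples the minimum.\<close>

lemma geometric_burke:
  assumes p: "p \<in> {0<..1}" and \<alpha>: "\<alpha> \<in> {0<..1}" and \<beta>: "\<beta> \<in> {0<..1}"
    and eq: "(1 - \<alpha>) * (1 - \<beta>) = 1 - p"
  shows "do {i \<leftarrow> geometric_pmf \<alpha>; j \<leftarrow> geometric_pmf \<beta>; w \<leftarrow> geometric_pmf p;
      return_pmf (w + (i - j), w + (j - i))} = pair_pmf (geometric_pmf \<alpha>) (geometric_pmf \<beta>)"
    (is "?L = _")
proof (rule pmf_eqI)
  fix z :: "nat \<times> nat"
  obtain x y where z: "z = (x, y)" by force
  let ?A = "geometric_pmf \<alpha>" and ?B = "geometric_pmf \<beta>" and ?W = "geometric_pmf p"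
  have L1: "?L = do {j \<leftarrow> ?B; map_pmf (\<lambda>(i, w). (w + (i - j), w + (j - i))) (pair_pmf ?A ?W)}"
    by (subst bind_commute_pmf) (simp add: pair_pmf_def map_bind_pmf)
  \<comment> \<open>Swapping the coordinates exchanges \<open>\<alpha>\<close> and
    \<open>\<beta>\<close> and settles the case \<open>x < y\<close>.\<close>
  have L2: "map_pmf prod.swap ?L = do {j \<leftarrow> ?A; map_pmf (\<lambda>(i, w). (w + (i - j), w + (j - i))) (pair_pmf ?B ?W)}"
    by (simp add: pair_pmf_def map_bind_pmf)
  show "pmf ?L z = pmf (pair_pmf ?A ?B) z"
  proof (cases "y \<le> x")
    case True
    then show ?thesis using geometric_pair_aux[OF p \<alpha> \<beta> eq True] unfolding L1 z by (simp add: pmf_pair)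
  next
    case False
    then have xy: "x \<le> y" by simp
    have "pmf ?L z = pmf (map_pmf prod.swap ?L) (prod.swap z)"
      by (rule pmf_map_inj'[symmetric]) auto
    also have "\<dots> = pmf ?B y * pmf ?A x"
      using geometric_pair_aux[OF p \<beta> \<alpha> _ xy] eq unfolding L2 z by (simp add: mult.commute)
    finally show ?thesis unfolding z by (simp add: pmf_pair mult.commute)
  qed
qed

text \<open>Raising \<open>i\<close>, \<open>j\<close> and \<open>w\<close> by one keeps the
  differences and raises both outputs by one.\<close>

lemma geometric1_burke:
  assumes "p \<in> {0<..1}" "\<alpha> \<in> {0<..1}" "\<beta> \<in> {0<..1}" "(1 - \<alpha>) * (1 - \<beta>) = 1 - p"
  shows "do {i \<leftarrow> geometric1_pmf \<alpha>; j \<leftarrow> geometric1_pmf \<beta>; w \<leftarrow> geometric1_pmf p; return_pmf (w + (i - j), w + (j - i))}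
    = pair_pmf (geometric1_pmf \<alpha>) (geometric1_pmf \<beta>)"
proof -
  have "do {i \<leftarrow> geometric1_pmf \<alpha>; j \<leftarrow> geometric1_pmf \<beta>; w \<leftarrow> geometric1_pmf p; return_pmf (w + (i - j), w + (j - i))}
    = map_pmf (map_prod Suc Suc) (do {i \<leftarrow> geometric_pmf \<alpha>; j \<leftarrow> geometric_pmf \<beta>; w \<leftarrow> geometric_pmf p;
      return_pmf (w + (i - j), w + (j - i))})"
    by (simp add: geometric1_pmf_def bind_map_pmf map_bind_pmf)
  also have "\<dots> = pair_pmf (geometric1_pmf \<alpha>) (geometric1_pmf \<beta>)"
    unfolding geometric_burke[OF assms] geometric1_pmf_def by (simp add: map_prod_def map_pair)
  finally show ?thesis .
qed

text \<open>In the state \<open>F\<close>, \<open>Inl i\<close> and \<open>Inr j\<close> carry the increments of the passage time across column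
  \<open>i\<close> and row \<open>j\<close> along the boundary of the region processed so far. Processing a cell of weight
  \<open>x\<close> is the recursion \<open>G (i + 1) (j + 1) = max (G i (j + 1)) (G (i + 1) j) + x\<close> in terms of
  increments; the truncated subtraction is a positive part.\<close>

primrec cell :: "nat \<Rightarrow> nat \<times> nat \<Rightarrow> (nat + nat \<Rightarrow> nat) \<Rightarrow> nat + nat \<Rightarrow> nat" where
  "cell x (i, j) F = F(Inl i := x + (F (Inl i) - F (Inr j)), Inr j := x + (F (Inr j) - F (Inl i)))"

abbreviation cells_fold :: "(nat \<times> nat \<Rightarrow> nat) \<Rightarrow> (nat \<times> nat) list \<Rightarrow> (nat + nat \<Rightarrow> nat) \<Rightarrow> nat + nat \<Rightarrow> nat" where
  "cells_fold w \<equiv> fold (\<lambda>c. cell (w c) c)"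

text \<open>Row by row, so that each cell comes after its left and lower neighbours.\<close>

primrec cells :: "nat \<Rightarrow> nat \<Rightarrow> (nat \<times> nat) list" where
  "cells m 0 = []"
| "cells m (Suc n) = cells m n @ map (\<lambda>i. (i, n)) [0..<m]"

lemma set_cells: "set (cells m n) = {..<m} \<times> {..<n}"
proof (induction n)
  case (Suc n)
  have "{..<m} \<times> {..<Suc n} = {..<m} \<times> {..<n} \<union> (\<lambda>i. (i, n)) ` {0..<m}"
    by (auto simp: less_Suc_eq)
  with Suc show ?case by simp
qed simp

lemma distinct_cells: "distinct (cells m n)"
  by (induction n) (auto simp: set_cells distinct_map inj_on_def)

text \<open>Peel the upper right cell off the box; the rest of the chain avoids the last row or the
  last column.\<close>

lemma sum_cell_chain_le:
  fixes g :: "nat \<Rightarrow> nat \<Rightarrow> nat"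
  assumes "\<And>i j. i < m \<Longrightarrow> j < n \<Longrightarrow> g (Suc i) j + w (i, j) \<le> g (Suc i) (Suc j)"
    and "\<And>i j. i < m \<Longrightarrow> j < n \<Longrightarrow> g i (Suc j) + w (i, j) \<le> g (Suc i) (Suc j)"
    and "i \<le> m" "j \<le> n" "K \<subseteq> {..<i} \<times> {..<j}" "cell_chain K"
  shows "sum w K \<le> g i j"
  using assms(3-)
proof (induction "i + j" arbitrary: i j K rule: less_induct)
  case less
  show ?case
  proof (cases "i = 0 \<or> j = 0")
    case True
    with less.prems have "K = {}" by auto
    then show ?thesis by simp
  next
    case False
    then obtain i' j' where ij: "i = Suc i'" "j = Suc j'" by (meson not0_implies_Suc)
    let ?K = "K - {(i', j')}"
    have fK: "finite K" using less.prems(3) finite_subset by blast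
    have chain: "cell_chain ?K" using less.prems(4) unfolding cell_chain_def by blast
    \<comment> \<open>A cell of the last row and one of the last column, both different from the
      corner, are incomparable.\<close>
    have "?K \<subseteq> {..<Suc i'} \<times> {..<j'} \<or> ?K \<subseteq> {..<i'} \<times> {..<Suc j'}"
    proof (rule ccontr)
      assume "\<not> ?thesis"
      then obtain a b where ab: "a \<in> ?K" "b \<in> ?K" "a \<notin> {..<Suc i'} \<times> {..<j'}" "b \<notin> {..<i'} \<times> {..<Suc j'}"
        by blast
      then have "a \<in> {..<i} \<times> {..<j}" "b \<in> {..<i} \<times> {..<j}" using less.prems(3) by blast+
      with ab ij have "snd a = j'" "fst a < i'" "fst b = i'" "snd b < j'"
        by (cases a; cases b; auto simp: less_Suc_eq)+
      then show False using chain ab(1,2) unfolding cell_chain_def cell_le_def by force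
    qed
    then have "sum w ?K + w (i', j') \<le> g i j"
    proof
      assume "?K \<subseteq> {..<Suc i'} \<times> {..<j'}"
      from less.hyps[OF _ _ _ this chain] less.prems(1,2) assms(1)[of i' j'] ij show ?thesis by simp
    next
      assume "?K \<subseteq> {..<i'} \<times> {..<Suc j'}"
      from less.hyps[OF _ _ _ this chain] less.prems(1,2) assms(2)[of i' j'] ij show ?thesis by simp
    qed
    moreover have "sum w K \<le> sum w ?K + w (i', j')"
      using fK by (cases "(i', j') \<in> K") (auto simp: sum.remove)
    ultimately show ?thesis by linarith
  qed
qed

section \<open>Passage times recovered from boundary increments\<close>

definition row_state :: "(nat \<times> nat \<Rightarrow> nat) \<Rightarrow> (nat + nat \<Rightarrow> nat) \<Rightarrow> nat \<Rightarrow> nat \<Rightarrow> nat \<Rightarrow> nat + nat \<Rightarrow> nat" where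
  "row_state w F m n i = cells_fold w (cells m n @ map (\<lambda>i. (i, n)) [0..<i]) F"

lemma row_state_0: "row_state w F m n 0 = cells_fold w (cells m n) F"
  by (simp add: row_state_def)

lemma row_state_Suc: "row_state w F m n (Suc i) = cell (w (i, n)) (i, n) (row_state w F m n i)"
  by (simp add: row_state_def)

lemma row_state_full: "row_state w F m n m = row_state w F m (Suc n) 0"
  by (simp add: row_state_def)

lemma row_state_Inl_ge: "i \<le> k \<Longrightarrow> row_state w F m n i (Inl k) = row_state w F m n 0 (Inl k)"
  by (induction i) (auto simp: row_state_Suc)

lemma row_state_Inl_less: "i < i' \<Longrightarrow> row_state w F m n i' (Inl i) = row_state w F m n (Suc i) (Inl i)"
  by (induction i') (auto simp: row_state_Suc less_Suc_eq)

lemma row_state_Inr_other: "k \<noteq> n \<Longrightarrow> row_state w F m n i (Inr k) = row_state w F m n 0 (Inr k)"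
  by (induction i) (auto simp: row_state_Suc)

lemma row_state_Inr_ge: "n \<le> k \<Longrightarrow> row_state w F m n 0 (Inr k) = F (Inr k)"
proof (induction n)
  case (Suc n)
  then show ?case
    using row_state_Inr_other[of k n w F m m] by (simp add: row_state_full[symmetric])
qed (simp add: row_state_def)

text \<open>Both ways around a cell agree: new \<open>Inr\<close> plus old \<open>Inl\<close> and
  new \<open>Inl\<close> plus old \<open>Inr\<close> both equal the weight plus the maximum of the
  old values. Along a row this telescopes.\<close>

lemma row_state_balance:
  "row_state w F m n i (Inr n) + (\<Sum>k<i. row_state w F m n 0 (Inl k)) =
   F (Inr n) + (\<Sum>k<i. row_state w F m n i (Inl k))"
proof (induction i)
  case 0
  then show ?case by (simp add: row_state_Inr_ge)
next
  case (Suc i)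
  let ?S = "row_state w F m n"
  have eq: "(\<Sum>k<i. ?S (Suc i) (Inl k)) = (\<Sum>k<i. ?S i (Inl k))"
    by (auto simp: row_state_Suc intro!: sum.cong)
  have "?S i (Inl i) = ?S 0 (Inl i)" by (rule row_state_Inl_ge) simp
  with Suc show ?case unfolding sum.lessThan_Suc eq by (simp add: row_state_Suc)
qed

lemma passage_time_le_boundary:
  "passage_time ({..<m} \<times> {..<n}) w \<le> (\<Sum>j<n. F (Inr j)) + (\<Sum>i<m. cells_fold w (cells m n) F (Inl i))"
proof -
  let ?S = "row_state w F m"
  \<comment> \<open>The passage time with boundary at the grid point \<open>(i, j)\<close>: up the
    left side, then right at height \<open>j\<close>.\<close>
  define g where "g i j = (\<Sum>k<j. F (Inr k)) + (\<Sum>k<i. ?S j 0 (Inl k))" for i j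
  \<comment> \<open>Path independence across row \<open>j\<close>: crossing it first and then going
    right equals going right first and crossing it at column \<open>i\<close>.\<close>
  have step: "F (Inr j) + (\<Sum>k<i. ?S (Suc j) 0 (Inl k)) = ?S j i (Inr j) + (\<Sum>k<i. ?S j 0 (Inl k))"
    if "i \<le> m" for i j
  proof -
    have "(\<Sum>k<i. ?S (Suc j) 0 (Inl k)) = (\<Sum>k<i. ?S j i (Inl k))"
    proof (rule sum.cong)
      fix k assume "k \<in> {..<i}"
      then show "?S (Suc j) 0 (Inl k) = ?S j i (Inl k)"
        unfolding row_state_full[symmetric] using that
        by (simp add: row_state_Inl_less[of k m] row_state_Inl_less[of k i])
    qed simp
    then show ?thesis using row_state_balance[of w F m j i] by simp
  qed
  have g: "g i (Suc j) = (\<Sum>k<j. F (Inr k)) + ?S j i (Inr j) + (\<Sum>k<i. ?S j 0 (Inl k))" if "i \<le> m" for i j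
    using step[OF that, of j] by (simp add: g_def)
  have "sum w K \<le> g m n" if "K \<subseteq> {..<m} \<times> {..<n}" "cell_chain K" for K
  proof (rule sum_cell_chain_le[OF _ _ order_refl order_refl that])
    fix i j assume ij: "i < m" "j < n"
    have c: "?S j i (Inl i) = ?S j 0 (Inl i)" by (rule row_state_Inl_ge) simp
    show "g (Suc i) j + w (i, j) \<le> g (Suc i) (Suc j)"
      using ij by (subst g) (auto simp: g_def row_state_Suc)
    show "g i (Suc j) + w (i, j) \<le> g (Suc i) (Suc j)"
      using ij c by (subst (1 2) g) (auto simp: row_state_Suc)
  qed
  then show ?thesis by (subst passage_time_le_iff) (auto simp: g_def row_state_0)
qed

section \<open>Invariance of the boundary law\<close>

definition boundary_pmf :: "real \<Rightarrow> real \<Rightarrow> nat \<Rightarrow> nat \<Rightarrow> (nat + nat \<Rightarrow> nat) pmf" where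
  "boundary_pmf \<alpha> \<beta> m n = Pi_pmf ({..<m} <+> {..<n}) 0 (case_sum (\<lambda>_. geometric1_pmf \<alpha>) (\<lambda>_. geometric1_pmf \<beta>))"

context
  fixes p \<alpha> \<beta> :: real
  assumes p: "p \<in> {0<..1}" and \<alpha>: "\<alpha> \<in> {0<..1}" and \<beta>: "\<beta> \<in> {0<..1}"
    and eq: "(1 - \<alpha>) * (1 - \<beta>) = 1 - p"
begin

text \<open>A cell touches only \<open>Inl i\<close> and \<open>Inr j\<close>; the Burke identity
  preserves the joint law of these two, and the others are independent of them.\<close>

lemma boundary_pmf_cell:
  assumes "i < m" "j < n"
  shows "do {F \<leftarrow> boundary_pmf \<alpha> \<beta> m n; x \<leftarrow> geometric1_pmf p; return_pmf (cell x (i, j) F)} = boundary_pmf \<alpha> \<beta> m n"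
proof -
  define X where "X = ({..<m} <+> {..<n}) - {Inl i, Inr j}"
  let ?P = "case_sum (\<lambda>_. geometric1_pmf \<alpha>) (\<lambda>_. geometric1_pmf \<beta>)"
  let ?X = "Pi_pmf X 0 ?P"
  have I: "{..<m} <+> {..<n} = insert (Inl i) (insert (Inr j) X)" using assms by (auto simp: X_def)
  have X: "finite X" "Inl i \<notin> insert (Inr j) X" "Inr j \<notin> X" by (auto simp: X_def)
  have 1: "boundary_pmf \<alpha> \<beta> m n = do {a \<leftarrow> geometric1_pmf \<alpha>; b \<leftarrow> geometric1_pmf \<beta>; G \<leftarrow> ?X; return_pmf (G(Inr j := b, Inl i := a))}"
    unfolding boundary_pmf_def I using X
    by (simp add: Pi_pmf_insert' bind_assoc_pmf bind_return_pmf)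
  have 2: "cell x (i, j) (G(Inr j := b, Inl i := a)) = G(Inr j := x + (b - a), Inl i := x + (a - b))" for x G a b
    by (auto simp: fun_eq_iff)
  have "do {F \<leftarrow> boundary_pmf \<alpha> \<beta> m n; x \<leftarrow> geometric1_pmf p; return_pmf (cell x (i, j) F)}
    = do {a \<leftarrow> geometric1_pmf \<alpha>; b \<leftarrow> geometric1_pmf \<beta>; G \<leftarrow> ?X; x \<leftarrow> geometric1_pmf p; return_pmf (G(Inr j := x + (b - a), Inl i := x + (a - b)))}"
    unfolding 1 by (simp add: bind_assoc_pmf bind_return_pmf 2 del: cell.simps)
  also have "\<dots> = do {a \<leftarrow> geometric1_pmf \<alpha>; b \<leftarrow> geometric1_pmf \<beta>; x \<leftarrow> geometric1_pmf p; G \<leftarrow> ?X; return_pmf (G(Inr j := x + (b - a), Inl i := x + (a - b)))}"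
    by (subst bind_commute_pmf) (rule refl)
  also have "\<dots> = do {(a, b) \<leftarrow> do {a \<leftarrow> geometric1_pmf \<alpha>; b \<leftarrow> geometric1_pmf \<beta>; x \<leftarrow> geometric1_pmf p; return_pmf (x + (a - b), x + (b - a))};
      G \<leftarrow> ?X; return_pmf (G(Inr j := b, Inl i := a))}"
    by (simp add: bind_assoc_pmf bind_return_pmf)
  also have "\<dots> = boundary_pmf \<alpha> \<beta> m n"
    unfolding geometric1_burke[OF p \<alpha> \<beta> eq] 1 by (simp add: pair_pmf_def bind_assoc_pmf bind_return_pmf)
  finally show ?thesis .
qed

text \<open>Distinct cells use distinct weights, so each weight is fresh when its cell is
  processed.\<close>

lemma boundary_pmf_fold:
  assumes "distinct cs" "set cs \<subseteq> {..<m} \<times> {..<n}"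
  shows "do {F \<leftarrow> boundary_pmf \<alpha> \<beta> m n; w \<leftarrow> Pi_pmf (set cs) 0 (\<lambda>_. geometric1_pmf p); return_pmf (cells_fold w cs F)}
    = boundary_pmf \<alpha> \<beta> m n"
  using assms
proof (induction cs)
  case Nil
  then show ?case by (simp add: bind_return_pmf bind_return_pmf')
next
  case (Cons c cs)
  let ?W = "Pi_pmf (set cs) 0 (\<lambda>_. geometric1_pmf p)"
  obtain i j where c: "c = (i, j)" by force
  have f: "cells_fold (\<lambda>d. if d = c then x else w d) cs G = cells_fold w cs G" for w x G
    using Cons.prems by (intro fold_cong) auto
  have "do {F \<leftarrow> boundary_pmf \<alpha> \<beta> m n; w \<leftarrow> Pi_pmf (set (c # cs)) 0 (\<lambda>_. geometric1_pmf p); return_pmf (cells_fold w (c # cs) F)}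
    = do {F \<leftarrow> boundary_pmf \<alpha> \<beta> m n; x \<leftarrow> geometric1_pmf p; w \<leftarrow> ?W; return_pmf (cells_fold w cs (cell x c F))}"
    using Cons.prems by (simp add: Pi_pmf_insert' bind_assoc_pmf bind_return_pmf f del: cell.simps)
  also have "\<dots> = do {F \<leftarrow> do {F \<leftarrow> boundary_pmf \<alpha> \<beta> m n; x \<leftarrow> geometric1_pmf p; return_pmf (cell x (i, j) F)};
      w \<leftarrow> ?W; return_pmf (cells_fold w cs F)}"
    unfolding c by (simp add: bind_assoc_pmf bind_return_pmf del: cell.simps)
  also have "\<dots> = boundary_pmf \<alpha> \<beta> m n"
    using Cons by (subst boundary_pmf_cell) (auto simp: c)
  finally show ?case .
qed

lemma nn_integral_boundary_Inl:
  "i < m \<Longrightarrow> (\<integral>\<^sup>+F. of_nat (F (Inl i)) \<partial>boundary_pmf \<alpha> \<beta> m n) = ennreal (1 / \<alpha>)"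
proof -
  assume "i < m"
  then have "map_pmf (\<lambda>F. F (Inl i)) (boundary_pmf \<alpha> \<beta> m n) = geometric1_pmf \<alpha>"
    unfolding boundary_pmf_def by (subst Pi_pmf_component) auto
  from arg_cong[OF this, of "\<lambda>q. \<integral>\<^sup>+x. of_nat x \<partial>measure_pmf q"] show ?thesis
    by (simp add: nn_integral_geometric1[OF \<alpha>])
qed

lemma nn_integral_boundary_Inr:
  "j < n \<Longrightarrow> (\<integral>\<^sup>+F. of_nat (F (Inr j)) \<partial>boundary_pmf \<alpha> \<beta> m n) = ennreal (1 / \<beta>)"
proof -
  assume "j < n"
  then have "map_pmf (\<lambda>F. F (Inr j)) (boundary_pmf \<alpha> \<beta> m n) = geometric1_pmf \<beta>"
    unfolding boundary_pmf_def by (subst Pi_pmf_component) auto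
  from arg_cong[OF this, of "\<lambda>q. \<integral>\<^sup>+x. of_nat x \<partial>measure_pmf q"] show ?thesis
    by (simp add: nn_integral_geometric1[OF \<beta>])
qed

text \<open>The left side has \<open>n\<close> increments of mean \<open>1 / \<beta>\<close>. By
  invariance the top side, read after all cells are processed, still has \<open>m\<close> increments
  of mean \<open>1 / \<alpha>\<close>.\<close>

lemma mean_passage_time_le_stationary:
  "mean_passage_time p ({..<m} \<times> {..<n}) ({..<m} \<times> {..<n}) \<le> ennreal (m / \<alpha> + n / \<beta>)"
proof -
  let ?R = "{..<m} \<times> {..<n}"
  let ?W = "Pi_pmf ?R 0 (\<lambda>_. geometric1_pmf p)" and ?Q = "boundary_pmf \<alpha> \<beta> m n"
  have "mean_passage_time p ?R ?R = (\<integral>\<^sup>+F. \<integral>\<^sup>+w. of_nat (passage_time ?R w) \<partial>?W \<partial>?Q)"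
    unfolding mean_passage_time_def by (simp add: measure_pmf.emeasure_space_1)
  also have "\<dots> \<le> (\<integral>\<^sup>+F. \<integral>\<^sup>+w. of_nat (\<Sum>j<n. F (Inr j)) + of_nat (\<Sum>i<m. cells_fold w (cells m n) F (Inl i)) \<partial>?W \<partial>?Q)"
    unfolding of_nat_add[symmetric] by (intro nn_integral_mono of_nat_mono passage_time_le_boundary)
  also have "\<dots> = (\<integral>\<^sup>+F. of_nat (\<Sum>j<n. F (Inr j)) \<partial>?Q) +
      (\<integral>\<^sup>+F. \<integral>\<^sup>+w. of_nat (\<Sum>i<m. cells_fold w (cells m n) F (Inl i)) \<partial>?W \<partial>?Q)"
    by (simp add: nn_integral_add measure_pmf.emeasure_space_1)
  also have "(\<integral>\<^sup>+F. \<integral>\<^sup>+w. of_nat (\<Sum>i<m. cells_fold w (cells m n) F (Inl i)) \<partial>?W \<partial>?Q)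
      = (\<integral>\<^sup>+F. of_nat (\<Sum>i<m. F (Inl i))
          \<partial>measure_pmf (do {F \<leftarrow> ?Q; w \<leftarrow> ?W; return_pmf (cells_fold w (cells m n) F)}))"
    by simp
  also have "do {F \<leftarrow> ?Q; w \<leftarrow> ?W; return_pmf (cells_fold w (cells m n) F)} = ?Q"
    using boundary_pmf_fold[OF distinct_cells, of m n m n] by (simp add: set_cells)
  also have "(\<integral>\<^sup>+F. of_nat (\<Sum>j<n. F (Inr j)) \<partial>?Q) = (\<Sum>j<n. ennreal (1 / \<beta>))"
    by (simp add: nn_integral_sum nn_integral_boundary_Inr)
  also have "(\<integral>\<^sup>+F. of_nat (\<Sum>i<m. F (Inl i)) \<partial>?Q) = (\<Sum>i<m. ennreal (1 / \<alpha>))"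
    by (simp add: nn_integral_sum nn_integral_boundary_Inl)
  also have "(\<Sum>j<n. ennreal (1 / \<beta>)) + (\<Sum>i<m. ennreal (1 / \<alpha>)) = ennreal (m / \<alpha> + n / \<beta>)"
    using \<alpha> \<beta> by (subst (1 2) sum_ennreal) (auto simp flip: ennreal_plus simp: add.commute)
  finally show ?thesis .
qed

end

lemma mean_passage_time_le:
  assumes p: "0 < p" "p \<le> 1"
  shows "mean_passage_time p ({..<m} \<times> {..<n}) ({..<m} \<times> {..<n}) \<le> ennreal ((real m + real n + 2 * sqrt ((1 - p) * real m * real n)) / p)"
proof (cases "m = 0 \<or> n = 0")
  \<comment> \<open>The minimizer used below needs positive side lengths; an empty rectangle has
    passage time zero.\<close>
  case True
  then have "{..<m} \<times> {..<n} = {}" by auto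
  moreover have "passage_time {} w = 0" for w
    using passage_time_le_iff[of "{}" w 0] by simp
  ultimately show ?thesis by (simp add: mean_passage_time_def del: Times_empty)
next
  case False
  define x y s where "x = sqrt (real m)" and "y = sqrt (real n)" and "s = sqrt (1 - p)"
  have pos: "x > 0" "y > 0" "s \<ge> 0" "s < 1" using False p by (auto simp: x_def y_def s_def)
  have sq: "x * x = m" "y * y = n" "s * s = 1 - p" using p by (auto simp: x_def y_def s_def)
  text \<open>The minimizer of \<open>m / \<alpha> + n / \<beta>\<close> subject to \<open>(1 - \<alpha>) * (1 - \<beta>) = 1 - p\<close>.\<close>
  define \<alpha> \<beta> where "\<alpha> = p * x / (x + s * y)" and "\<beta> = p * y / (y + s * x)"
  have d: "x + s * y > 0" "y + s * x > 0" using pos by (auto intro: add_pos_nonneg)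
  have p': "p = 1 - s * s" using sq by simp
  \<comment> \<open>The two fractions are reciprocal up to the factor \<open>s\<close>, so their
    product is \<open>s * s\<close>.\<close>
  have 1: "1 - \<alpha> = s * (y + s * x) / (x + s * y)" "1 - \<beta> = s * (x + s * y) / (y + s * x)"
    unfolding \<alpha>_def \<beta>_def p' using d by (auto simp: field_simps)
  have eq: "(1 - \<alpha>) * (1 - \<beta>) = 1 - p"
  proof -
    have "s * a / b * (s * b / a) = s * s" if "a > 0" "b > 0" for a b
      using that by (simp add: field_simps)
    from this[OF d(2,1)] show ?thesis unfolding 1 sq .
  qed
  have "1 - \<alpha> \<ge> 0" "1 - \<beta> \<ge> 0" unfolding 1 using pos d by (auto intro!: divide_nonneg_pos mult_nonneg_nonneg)
  moreover have "\<alpha> > 0" "\<beta> > 0" unfolding \<alpha>_def \<beta>_def using pos d p by auto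
  ultimately have "mean_passage_time p ({..<m} \<times> {..<n}) ({..<m} \<times> {..<n}) \<le> ennreal (m / \<alpha> + n / \<beta>)"
    using p eq by (intro mean_passage_time_le_stationary) auto
  also have "m / \<alpha> + n / \<beta> = (x * (x + s * y) + y * (y + s * x)) / p"
    unfolding \<alpha>_def \<beta>_def sq[symmetric] using pos d p by (simp add: field_simps)
  also have "\<dots> = (real m + real n + 2 * (s * x * y)) / p"
    by (simp add: algebra_simps sq)
  also have "s * x * y = sqrt ((1 - p) * m * n)"
    unfolding s_def x_def y_def by (simp only: real_sqrt_mult)
  finally show ?thesis .
qed

section \<open>Bracket vectors\<close>

abbreviation (input) "nN s \<equiv> count_list s North"
abbreviation (input) "nE s \<equiv> count_list s East"

text \<open>Call the east steps of \<open>\<nu>\<close> columns, numbered from left to right, and let \<open>h c\<close> be the height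
  of column \<open>c\<close>. A path \<open>\<mu>\<close> above \<open>\<nu>\<close> is run as a stack machine: arriving at height \<open>y\<close> pushes the
  columns of height \<open>y\<close>, and each east step of \<open>\<mu>\<close> pops the top, that is the largest column on the
  stack. The state is the current height \<open>y\<close> together with the set \<open>A\<close> of columns not yet popped;
  \<open>pop\<close> records the height at which each column is popped (and is \<open>0\<close> off \<open>A\<close>).\<close>

locale heights =
  fixes m n :: nat and h :: "nat \<Rightarrow> nat"
  assumes h_mono: "c \<le> d \<Longrightarrow> d < m \<Longrightarrow> h c \<le> h d"
    and h_le: "c < m \<Longrightarrow> h c \<le> n"
begin

definition avail :: "nat set \<Rightarrow> nat \<Rightarrow> nat set" where
  "avail A y = {c\<in>A. h c \<le> y}"

definition top_col :: "nat set \<Rightarrow> nat \<Rightarrow> nat" where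
  "top_col A y = Max (avail A y)"

fun legal :: "nat \<Rightarrow> nat set \<Rightarrow> step list \<Rightarrow> bool" where
  "legal y A [] \<longleftrightarrow> True"
| "legal y A (North # s) \<longleftrightarrow> legal (Suc y) A s"
| "legal y A (East # s) \<longleftrightarrow> avail A y \<noteq> {} \<and> legal y (A - {top_col A y}) s"

fun rest :: "nat \<Rightarrow> nat set \<Rightarrow> step list \<Rightarrow> nat set" where
  "rest y A [] = A"
| "rest y A (North # s) = rest (Suc y) A s"
| "rest y A (East # s) = rest y (A - {top_col A y}) s"

fun pop :: "nat \<Rightarrow> nat set \<Rightarrow> step list \<Rightarrow> nat \<Rightarrow> nat" where
  "pop y A [] = (\<lambda>_. 0)"
| "pop y A (North # s) = pop (Suc y) A s"
| "pop y A (East # s) = (pop y (A - {top_col A y}) s)(top_col A y := y)"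

lemma finite_avail [simp]: "finite A \<Longrightarrow> finite (avail A y)"
  by (simp add: avail_def)

lemma top_col_in: "finite A \<Longrightarrow> avail A y \<noteq> {} \<Longrightarrow> top_col A y \<in> avail A y"
  unfolding top_col_def by (rule Max_in) auto

lemma top_col_ge: "finite A \<Longrightarrow> c \<in> avail A y \<Longrightarrow> c \<le> top_col A y"
  unfolding top_col_def by (rule Max_ge) auto

lemma legal_append: "legal y A (s @ t) \<longleftrightarrow> legal y A s \<and> legal (y + nN s) (rest y A s) t"
  by (induction y A s rule: legal.induct) auto

lemma rest_append: "rest y A (s @ t) = rest (y + nN s) (rest y A s) t"
  by (induction y A s rule: rest.induct) auto

lemma rest_subset: "rest y A s \<subseteq> A"
  by (induction y A s rule: rest.induct) auto

lemma finite_rest: "finite A \<Longrightarrow> finite (rest y A s)"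
  by (rule finite_subset[OF rest_subset])

lemma pop_outside: "legal y A s \<Longrightarrow> finite A \<Longrightarrow> c \<notin> A \<Longrightarrow> pop y A s c = 0"
proof (induction y A s rule: legal.induct)
  case (3 y A s)
  then have "c \<noteq> top_col A y" using top_col_in[of A y] by (auto simp: avail_def)
  with 3 show ?case by simp
qed auto

lemma pop_append:
  assumes "legal y A (s @ t)" "finite A"
  shows "pop y A (s @ t) c =
    (if c \<in> rest y A s then pop (y + nN s) (rest y A s) t c else pop y A s c)"
  using assms
proof (induction y A s rule: legal.induct)
  case (1 y A)
  then show ?case by (simp add: pop_outside)
next
  case (3 y A s)
  then show ?case using rest_subset[of y "A - {top_col A y}" s] by auto
qed auto

lemma pop_bounds:
  "legal y A s \<Longrightarrow> finite A \<Longrightarrow> c \<in> A - rest y A s \<Longrightarrow>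
    y \<le> pop y A s c \<and> pop y A s c \<le> y + nN s \<and> h c \<le> pop y A s c"
proof (induction y A s rule: legal.induct)
  case (2 y A s)
  then show ?case by force
next
  case (3 y A s)
  then show ?case using top_col_in[of A y] by (cases "c = top_col A y") (auto simp: avail_def)
qed auto

text \<open>Last in, first out: if \<open>d\<close> is pushed by the time \<open>c\<close> is
  popped, it lies above \<open>c\<close> on the stack and has left before.\<close>

lemma pop_nested:
  "legal y A s \<Longrightarrow> finite A \<Longrightarrow> rest y A s = {} \<Longrightarrow> c \<in> A \<Longrightarrow> d \<in> A \<Longrightarrow> c < d \<Longrightarrow>
    h d \<le> pop y A s c \<Longrightarrow> pop y A s d \<le> pop y A s c"
proof (induction y A s rule: legal.induct)
  case (3 y A s)
  let ?t = "top_col A y"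
  consider "c = ?t" | "d = ?t" "c \<noteq> ?t" | "c \<noteq> ?t" "d \<noteq> ?t" by blast
  then show ?case
  proof cases
    case 1
    then have "d \<in> avail A y" using 3 by (simp add: avail_def)
    then have "d \<le> ?t" using 3 top_col_ge by blast
    then show ?thesis using 1 3 by simp
  next
    case 2
    then show ?thesis using 3 pop_bounds[of y "A - {?t}" s c] by simp
  next
    case 3
    with "3.IH" "3.prems" show ?thesis by simp
  qed
qed auto

text \<open>The first step can be decoded: East pops the top column at height \<open>y\<close>,
  whereas after North every pop happens at \<open>Suc y\<close> or later.\<close>

lemma pop_inject:
  "legal y A s \<Longrightarrow> legal y A t \<Longrightarrow> finite A \<Longrightarrow> rest y A s = {} \<Longrightarrow> rest y A t = {} \<Longrightarrow>
    nN s = nN t \<Longrightarrow> (\<And>c. c \<in> A \<Longrightarrow> pop y A s c = pop y A t c) \<Longrightarrow> s = t"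
proof (induction y A s arbitrary: t rule: legal.induct)
  case (1 y A)
  then have A: "A = {}" by simp
  show ?case
  proof (cases t)
    case (Cons a t')
    then show ?thesis using 1 A by (cases a) (auto simp: avail_def)
  qed simp
next
  case (2 y A s)
  show ?case
  proof (cases t)
    case (Cons a t')
    show ?thesis
    proof (cases a)
      case East
      let ?t = "top_col A y"
      have "?t \<in> A" using 2 top_col_in[of A y] Cons East by (auto simp: avail_def)
      moreover from this have "Suc y \<le> pop (Suc y) A s ?t" using 2 pop_bounds[of "Suc y" A s ?t] by auto
      ultimately show ?thesis using "2.prems"(7)[of ?t] Cons East by simp
    next
      case North
      then show ?thesis using 2 Cons by simp
    qed
  qed (use 2 in simp)
next
  case (3 y A s)
  let ?t = "top_col A y"
  have t: "?t \<in> A" using 3 top_col_in[of A y] by (auto simp: avail_def)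
  show ?case
  proof (cases t)
    case Nil
    then show ?thesis using 3 t by auto
  next
    case (Cons a t')
    show ?thesis
    proof (cases a)
      case East
      have "s = t'"
      proof (rule "3.IH")
        fix c assume "c \<in> A - {?t}"
        then show "pop y (A - {?t}) s c = pop y (A - {?t}) t' c"
          using "3.prems"(7)[of c] Cons East by simp
      qed (use "3.prems" Cons East in auto)
      then show ?thesis using Cons East by simp
    next
      case North
      have "Suc y \<le> pop (Suc y) A t' ?t" using 3 t Cons North pop_bounds[of "Suc y" A t' ?t] by auto
      then show ?thesis using "3.prems"(7)[OF t] Cons North by simp
    qed
  qed
qed

text \<open>The vectors of pop heights (the \<open>\<nu>\<close>-bracket vectors): the intervals \<open>[h c, v c]\<close> are
  last-in-first-out.\<close>

definition nested :: "(nat \<Rightarrow> nat) \<Rightarrow> bool" where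
  "nested v \<longleftrightarrow> (\<forall>c<m. h c \<le> v c \<and> v c \<le> n) \<and>
     (\<forall>c d. c < d \<longrightarrow> d < m \<longrightarrow> h d \<le> v c \<longrightarrow> v d \<le> v c) \<and> (\<forall>c\<ge>m. v c = 0)"

text \<open>Greedy decoding: go East while some remaining column has value \<open>y\<close>,
  otherwise North.\<close>

lemma pop_surj:
  assumes v: "nested v"
  shows "A \<subseteq> {..<m} \<Longrightarrow> y \<le> n \<Longrightarrow> (\<And>c. c \<in> A \<Longrightarrow> y \<le> v c) \<Longrightarrow>
    \<exists>s. legal y A s \<and> rest y A s = {} \<and> y + nN s = n \<and> (\<forall>c\<in>A. pop y A s c = v c)"
proof (induction "(n - y) + card A" arbitrary: y A rule: less_induct)
  case less
  have fA: "finite A" using less.prems(1) finite_subset by blast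
  show ?case
  proof (cases "\<exists>c\<in>A. v c = y")
    case True
    then obtain c where c: "c \<in> A" "v c = y" by blast
    have cm: "c < m" using c less.prems by auto
    then have ca: "c \<in> avail A y" using c v unfolding avail_def nested_def by auto
    let ?t = "top_col A y"
    have t: "?t \<in> avail A y" using ca fA by (intro top_col_in) auto
    have tA: "?t \<in> A" "h ?t \<le> y" using t unfolding avail_def by auto
    have tm: "?t < m" using tA less.prems by auto
    \<comment> \<open>A column due at height \<open>y\<close> may lie below the top, but nestedness
      then makes the top due as well.\<close>
    have "v ?t \<le> y"
    proof (cases "?t = c")
      case False
      then have "c < ?t" using top_col_ge[OF fA ca] by simp
      then show ?thesis using v c tm tA(2) unfolding nested_def by metis
    qed (use c in simp)
    with less.prems(3)[OF tA(1)] have vt: "v ?t = y" by simp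
    have "card (A - {?t}) < card A" using tA fA by (intro card_Diff1_less) auto
    then have "\<exists>s. legal y (A - {?t}) s \<and> rest y (A - {?t}) s = {} \<and> y + nN s = n \<and>
        (\<forall>c\<in>A - {?t}. pop y (A - {?t}) s c = v c)"
      using less.prems by (intro less.hyps) auto
    then obtain s where "legal y (A - {?t}) s" "rest y (A - {?t}) s = {}" "y + nN s = n"
        "\<forall>c\<in>A - {?t}. pop y (A - {?t}) s c = v c" by blast
    then show ?thesis using ca vt by (intro exI[of _ "East # s"]) auto
  next
    case False
    then have gt: "Suc y \<le> v c" if "c \<in> A" for c using less.prems(3)[OF that] that by (metis le_antisym not_less_eq_eq)
    show ?thesis
    proof (cases "y = n")
      case True
      have "A = {}"
      proof (rule ccontr)
        assume "A \<noteq> {}"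
        then obtain c where "c \<in> A" by blast
        then have "v c \<le> n" "Suc n \<le> v c" using gt[of c] True less.prems(1) v unfolding nested_def by auto
        then show False by simp
      qed
      then show ?thesis using True by (intro exI[of _ "[]"]) simp
    next
      case False
      have "\<exists>s. legal (Suc y) A s \<and> rest (Suc y) A s = {} \<and> Suc y + nN s = n \<and> (\<forall>c\<in>A. pop (Suc y) A s c = v c)"
        using less.prems False gt by (intro less.hyps) auto
      then obtain s where "legal (Suc y) A s" "rest (Suc y) A s = {}" "Suc y + nN s = n"
          "\<forall>c\<in>A. pop (Suc y) A s c = v c" by blast
      then show ?thesis by (intro exI[of _ "North # s"]) auto
    qed
  qed
qed

text \<open>The size of the stack is the horizontal distance of the current point.\<close>

lemma card_avail_rest:
  "legal y A s \<Longrightarrow> finite A \<Longrightarrow> y + nN s \<le> z \<Longrightarrow> card (avail (rest y A s) z) + nE s = card (avail A z)"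
proof (induction y A s rule: legal.induct)
  case (3 y A s)
  let ?t = "top_col A y"
  have t: "?t \<in> avail A z" using 3 top_col_in[of A y] by (auto simp: avail_def)
  have "avail (A - {?t}) z = avail A z - {?t}" by (auto simp: avail_def)
  then have "Suc (card (avail (A - {?t}) z)) = card (avail A z)"
    using t 3 by (metis card_Suc_Diff1 finite_avail)
  with 3 show ?case by simp
qed auto

lemma card_rest: "legal y A s \<Longrightarrow> finite A \<Longrightarrow> card (rest y A s) + nE s = card A"
proof (induction y A s rule: legal.induct)
  case (3 y A s)
  let ?t = "top_col A y"
  have t: "?t \<in> A" using 3 top_col_in[of A y] by (auto simp: avail_def)
  then have "Suc (card (A - {?t})) = card A" using 3 by (metis card_Suc_Diff1)
  with 3 show ?case by simp
qed auto

lemma legal_take: "legal y A s \<Longrightarrow> legal y A (take k s)"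
  by (metis append_take_drop_id legal_append)

text \<open>Legality depends only on the size of the stack, and a path above \<open>\<nu>\<close>
  supplies exactly these counts.\<close>

lemma legalI:
  "finite A \<Longrightarrow> (\<And>k. k \<le> length s \<Longrightarrow> nE (take k s) \<le> card (avail A (y + nN (take k s)))) \<Longrightarrow> legal y A s"
proof (induction y A s rule: legal.induct)
  case (2 y A s)
  show ?case unfolding legal.simps
  proof (rule "2.IH")
    fix k assume "k \<le> length s"
    then show "nE (take k s) \<le> card (avail A (Suc y + nN (take k s)))"
      using "2.prems"(2)[of "Suc k"] by simp
  qed (use 2 in auto)
next
  case (3 y A s)
  let ?t = "top_col A y"
  have ne: "avail A y \<noteq> {}" using "3.prems"(2)[of 1] by auto
  have tz: "?t \<in> avail A z" if "y \<le> z" for z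
    using that ne top_col_in[of A y] "3.prems"(1) by (auto simp: avail_def)
  show ?case unfolding legal.simps
  proof (intro conjI ne "3.IH")
    fix k assume k: "k \<le> length s"
    let ?z = "y + nN (take k s)"
    have "avail (A - {?t}) ?z = avail A ?z - {?t}" by (auto simp: avail_def)
    then have "Suc (card (avail (A - {?t}) ?z)) = card (avail A ?z)"
      using tz[of ?z] 3 by (metis card_Suc_Diff1 finite_avail le_add1)
    then show "nE (take k s) \<le> card (avail (A - {?t}) ?z)"
      using "3.prems"(2)[of "Suc k"] k by simp
  qed (use 3 in auto)
qed auto

section \<open>Stack excursions and the cover relation\<close>

definition open_cols :: "nat \<Rightarrow> nat set \<Rightarrow> step list \<Rightarrow> nat set" where
  "open_cols y A s = avail (rest y A s) (y + nN s)"

lemma open_cols_snoc_North: "open_cols y A s \<subseteq> open_cols y A (s @ [North])"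
  by (auto simp: open_cols_def rest_append avail_def)

lemma open_cols_snoc_East:
  "open_cols y A (s @ [East]) = open_cols y A s - {top_col (rest y A s) (y + nN s)}"
  by (auto simp: open_cols_def rest_append avail_def)

lemma finite_open_cols [simp]: "finite A \<Longrightarrow> finite (open_cols y A s)"
  by (simp add: open_cols_def finite_rest)

text \<open>The stack may grow by several columns at once but shrinks by at most one, so a level
  cannot be skipped on the way down.\<close>

lemma card_open_cols_snoc: "finite A \<Longrightarrow> card (open_cols y A s) \<le> Suc (card (open_cols y A (s @ [a])))"
proof (cases a)
  case North
  assume "finite A"
  then have "card (open_cols y A s) \<le> card (open_cols y A (s @ [a]))"
    unfolding North by (intro card_mono open_cols_snoc_North) auto
  then show ?thesis by simp
next
  case East
  assume "finite A"
  then show ?thesis unfolding East open_cols_snoc_East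
    by (auto simp: card_Diff_singleton_if)
qed

text \<open>The stack stays strictly above its initial height during \<open>D\<close>, so putting one more column \<open>c\<close>
  below does not change which columns \<open>D\<close> pops.\<close>

lemma excursion_frame:
  assumes A: "finite A" "A \<subseteq> {..<m}" and c: "c < m" "c \<notin> A" "h c \<le> y"
    and below: "\<And>e. e \<in> avail A y \<Longrightarrow> e < c"
    and D: "legal y A D" "D \<noteq> []" "hd D = North"
    and up: "\<And>k. 0 < k \<Longrightarrow> k < length D \<Longrightarrow> card (avail A y) < card (open_cols y A (take k D))"
  shows "k \<le> length D \<Longrightarrow>
    legal y (insert c A) (take k D) \<and> rest y (insert c A) (take k D) = insert c (rest y A (take k D)) \<and>
    avail A y \<subseteq> rest y A (take k D) \<and> (\<forall>e. pop y (insert c A) (take k D) e = pop y A (take k D) e)"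
proof (induction k)
  case 0
  then show ?case using c by (auto simp: avail_def)
next
  case (Suc k)
  then have k: "k < length D" by simp
  let ?s = "take k D" and ?z = "y + nN (take k D)"
  let ?R = "rest y A (take k D)"
  note IH = Suc.IH[OF less_imp_le[OF k]]
  have tk: "take (Suc k) D = ?s @ [D ! k]" by (rule take_Suc_conv_app_nth[OF k])
  have legk: "legal y A (?s @ [D ! k])" using legal_take[OF D(1), of "Suc k"] tk by simp
  have finR: "finite ?R" by (rule finite_rest[OF A(1)])
  have cc: "pop y A ?s c = 0" using c A D legal_take by (intro pop_outside) auto
  show ?case
  proof (cases "D ! k")
    case North
    then show ?thesis unfolding tk using IH legk A cc
      by (simp add: legal_append rest_append pop_append)
  next
    case East
    have k0: "0 < k"
    proof (rule ccontr)
      assume "\<not> 0 < k"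
      then show False using D East by (simp add: hd_conv_nth)
    qed
    \<comment> \<open>A stack larger than at the start holds a column higher than \<open>y\<close>;
      so does its top, which therefore lies to the right of \<open>c\<close>.\<close>
    have "card (avail A y) < card (open_cols y A ?s)" by (rule up[OF k0 k])
    then have "\<not> open_cols y A ?s \<subseteq> avail A y"
      using A card_mono[of "avail A y" "open_cols y A ?s"] by auto
    then obtain e where e: "e \<in> open_cols y A ?s" "e \<notin> avail A y" by blast
    let ?t = "top_col ?R ?z"
    have et: "e \<le> ?t" using e(1) finR unfolding open_cols_def by (intro top_col_ge)
    have tin: "?t \<in> avail ?R ?z" using e(1) finR unfolding open_cols_def by (intro top_col_in) auto
    have eA: "e \<in> A" using e(1) rest_subset[of y A ?s] unfolding open_cols_def avail_def by auto
    have tA: "?t \<in> A" using tin rest_subset[of y A ?s] unfolding avail_def by auto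
    have "y < h e" using e(2) eA unfolding avail_def by auto
    also have "h e \<le> h ?t" using et tA A by (intro h_mono) auto
    finally have yt: "y < h ?t" .
    have ct: "c < ?t"
    proof (rule ccontr)
      assume "\<not> c < ?t"
      then have "h ?t \<le> h c" using c by (intro h_mono) auto
      then show False using yt c by simp
    qed
    have av: "avail (insert c ?R) ?z = insert c (avail ?R ?z)" using c by (auto simp: avail_def)
    have top: "top_col (insert c ?R) ?z = ?t"
      unfolding top_col_def av using tin ct finR
      by (subst Max_insert) (auto simp: top_col_def max_def)
    have tB: "?t \<notin> avail A y" using yt by (auto simp: avail_def)
    have 1: "legal y (insert c A) (take (Suc k) D)"
      unfolding tk East legal_append using IH by (simp add: av)
    have 2: "rest y (insert c A) (take (Suc k) D) = insert c (rest y A (take (Suc k) D))"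
      unfolding tk East rest_append using IH ct by (auto simp: top)
    have 3: "avail A y \<subseteq> rest y A (take (Suc k) D)"
      unfolding tk East rest_append using IH tB by auto
    have 4: "pop y (insert c A) (take (Suc k) D) e = pop y A (take (Suc k) D) e" for e
    proof -
      have l1: "legal y (insert c A) (?s @ [East])" using 1 unfolding tk East .
      have l2: "legal y A (?s @ [East])" using legk unfolding East .
      show ?thesis
        unfolding tk East pop_append[OF l1 finite.insertI[OF A(1)]] pop_append[OF l2 A(1)]
        using IH top cc ct by auto
    qed
    show ?thesis using 1 2 3 4 by blast
  qed
qed

text \<open>By the frame property \<open>D\<close> pops the same columns at the same heights with
  \<open>c\<close> kept below. At the return \<open>c\<close> is on top, so only its pop height
  changes.\<close>

lemma cover_move:
  assumes leg: "legal 0 {..<m} (X @ [East] @ D @ Y)"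
    and fin: "rest 0 {..<m} (X @ [East] @ D @ Y) = {}"
    and y: "y = nN X" and A: "A = rest 0 {..<m} X" and c: "c = top_col A y"
    and D: "D \<noteq> []" "hd D = North"
    and up: "\<And>k. 0 < k \<Longrightarrow> k < length D \<Longrightarrow>
      card (open_cols y (A - {c}) []) < card (open_cols y (A - {c}) (take k D))"
    and ret: "card (open_cols y (A - {c}) D) = card (open_cols y (A - {c}) [])"
  shows "legal 0 {..<m} (X @ D @ [East] @ Y) \<and> rest 0 {..<m} (X @ D @ [East] @ Y) = {} \<and>
    pop 0 {..<m} (X @ D @ [East] @ Y) = (pop 0 {..<m} (X @ [East] @ D @ Y))(c := y + nN D) \<and>
    c < m \<and> pop 0 {..<m} (X @ [East] @ D @ Y) c = y"
proof -
  let ?A = "A - {c}"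
  have finA: "finite A" unfolding A by (simp add: finite_rest)
  have Am: "A \<subseteq> {..<m}" unfolding A by (rule rest_subset)
  have l: "legal 0 {..<m} X" "avail A y \<noteq> {}" "legal y ?A D" "legal (y + nN D) (rest y ?A D) Y"
    using leg unfolding A y c by (auto simp: legal_append rest_append)
  have cin: "c \<in> avail A y" unfolding c using l finA by (intro top_col_in)
  then have c': "c < m" "c \<in> A" "h c \<le> y" using Am by (auto simp: avail_def)
  have below: "e < c" if "e \<in> avail ?A y" for e
  proof -
    have "e \<in> avail A y" "e \<noteq> c" using that by (auto simp: avail_def)
    then show ?thesis unfolding c using top_col_ge[OF finA, of e y] by simp
  qed
  have oc: "open_cols y ?A [] = avail ?A y" by (simp add: open_cols_def)
  have F: "legal y (insert c ?A) D \<and> rest y (insert c ?A) D = insert c (rest y ?A D) \<and>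
      avail ?A y \<subseteq> rest y ?A D \<and> (\<forall>e. pop y (insert c ?A) D e = pop y ?A D e)"
    using excursion_frame[OF _ _ c'(1) _ c'(3) below l(3) D, of "length D"] finA Am up unfolding oc by auto
  have ins: "insert c ?A = A" using c' by auto
  note F = F[unfolded ins]
  let ?R = "rest y ?A D" and ?z = "y + nN D"
  have finR: "finite ?R" using finA by (simp add: finite_rest)
  have "avail ?A y \<subseteq> avail ?R ?z" using F by (auto simp: avail_def)
  \<comment> \<open>The old stack is still contained in the new one and has the same size.\<close>
  then have same: "avail ?R ?z = avail ?A y"
    using ret finR unfolding oc by (metis card_subset_eq finite_avail open_cols_def)
  have av: "avail (insert c ?R) ?z = insert c (avail ?R ?z)" using c' by (auto simp: avail_def)
  have top: "top_col (insert c ?R) ?z = c"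
  proof (cases "avail ?R ?z = {}")
    case True
    then show ?thesis unfolding top_col_def av by simp
  next
    case False
    then have "Max (avail ?R ?z) < c" using below finR unfolding same by (metis False Max_in finite_avail finA finite_Diff same)
    then show ?thesis unfolding top_col_def av using finR False by (subst Max_insert) auto
  qed
  have cR: "c \<notin> ?R" using rest_subset[of y ?A D] by auto
  have ins2: "insert c ?R - {c} = ?R" using cR by auto
  have leg': "legal 0 {..<m} (X @ D @ [East] @ Y)"
    using l F by (simp add: legal_append A[symmetric] y[symmetric] top av ins2)
  have rest': "rest 0 {..<m} (X @ D @ [East] @ Y) = rest 0 {..<m} (X @ [East] @ D @ Y)"
    using F by (simp add: rest_append A[symmetric] y[symmetric] top ins2 c[symmetric])
  have popXY: "pop 0 {..<m} (X @ [East] @ D @ Y) e =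
      (if e \<in> A then if e = c then y else if e \<in> ?R then pop ?z ?R Y e else pop y ?A D e else pop 0 {..<m} X e)" for e
  proof -
    have l1: "legal y ?A (D @ Y)" using l by (simp add: legal_append)
    have "pop y A ([East] @ D @ Y) e = (if e = c then y else pop y ?A (D @ Y) e)"
      by (simp add: c[symmetric])
    also have "pop y ?A (D @ Y) e = (if e \<in> ?R then pop ?z ?R Y e else pop y ?A D e)"
      by (rule pop_append[OF l1]) (use finA in simp)
    finally show ?thesis
      by (subst pop_append[OF leg]) (simp_all add: A[symmetric] y[symmetric])
  qed
  have popDE: "pop 0 {..<m} (X @ D @ [East] @ Y) e =
      (if e \<in> A then if e = c then ?z else if e \<in> ?R then pop ?z ?R Y e else pop y ?A D e else pop 0 {..<m} X e)" for e
  proof -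
    have l1: "legal y A (D @ [East] @ Y)" using leg' by (simp add: legal_append A[symmetric] y[symmetric])
    have "pop y A (D @ [East] @ Y) e =
        (if e \<in> rest y A D then pop ?z (rest y A D) ([East] @ Y) e else pop y A D e)"
      by (rule pop_append[OF l1 finA])
    also have "\<dots> = (if e = c then ?z else if e \<in> ?R then pop ?z ?R Y e else pop y ?A D e)"
      using F by (simp add: top ins2)
    finally show ?thesis
      by (subst pop_append[OF leg']) (simp_all add: A[symmetric] y[symmetric])
  qed
  have "pop 0 {..<m} (X @ D @ [East] @ Y) = (pop 0 {..<m} (X @ [East] @ D @ Y))(c := ?z)"
    unfolding fun_eq_iff popXY popDE fun_upd_apply using c' by auto
  moreover have "pop 0 {..<m} (X @ [East] @ D @ Y) c = y" unfolding popXY using c' by simp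
  ultimately show ?thesis using leg' rest' fin c' by simp
qed

lemma pop_split:
  "legal y A s \<Longrightarrow> finite A \<Longrightarrow> c \<in> A \<Longrightarrow> c \<notin> rest y A s \<Longrightarrow>
    \<exists>X Z. s = X @ East # Z \<and> top_col (rest y A X) (y + nN X) = c \<and> pop y A s c = y + nN X"
proof (induction y A s rule: legal.induct)
  case (2 y A s)
  then obtain X Z where "s = X @ East # Z" "top_col (rest (Suc y) A X) (Suc y + nN X) = c"
      "pop (Suc y) A s c = Suc y + nN X" by auto
  then show ?case by (intro exI[of _ "North # X"] exI[of _ Z]) simp
next
  case (3 y A s)
  show ?case
  proof (cases "c = top_col A y")
    case True
    then show ?thesis by (intro exI[of _ "[]"] exI[of _ s]) simp
  next
    case False
    with 3 obtain X Z where "s = X @ East # Z"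
        "top_col (rest y (A - {top_col A y}) X) (y + nN X) = c"
        "pop y (A - {top_col A y}) s c = y + nN X" by auto
    then show ?thesis using False by (intro exI[of _ "East # X"] exI[of _ Z]) simp
  qed
qed simp

lemma nested_pop:
  assumes "legal 0 {..<m} s" "rest 0 {..<m} s = {}" "nN s = n"
  shows "nested (pop 0 {..<m} s)"
  unfolding nested_def
proof (intro conjI allI impI)
  fix c assume "c < m"
  then show "h c \<le> pop 0 {..<m} s c" "pop 0 {..<m} s c \<le> n"
    using pop_bounds[OF assms(1), of c] assms by auto
next
  fix c d assume "c < d" "d < m" "h d \<le> pop 0 {..<m} s c"
  then show "pop 0 {..<m} s d \<le> pop 0 {..<m} s c"
    using assms by (intro pop_nested) auto
next
  fix c assume "m \<le> c"
  then show "pop 0 {..<m} s c = 0" using assms by (intro pop_outside) auto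
qed

text \<open>Delay the pop of the least column \<open>c\<close> where the vectors differ. Agreement
  to its left and nestedness of \<open>w\<close> keep the resulting move below
  \<open>w\<close>.\<close>

lemma cover_exists:
  assumes leg: "legal 0 {..<m} s" and fin: "rest 0 {..<m} s = {}" and n: "nN s = n"
    and w: "nested w" "\<And>c. c < m \<Longrightarrow> pop 0 {..<m} s c \<le> w c"
    and ne: "\<exists>c<m. pop 0 {..<m} s c \<noteq> w c"
  shows "\<exists>X D Y y A c. s = X @ [East] @ D @ Y \<and> y = nN X \<and> A = rest 0 {..<m} X \<and> c = top_col A y \<and>
    D \<noteq> [] \<and> hd D = North \<and>
    (\<forall>k. 0 < k \<longrightarrow> k < length D \<longrightarrow>
      card (open_cols y (A - {c}) []) < card (open_cols y (A - {c}) (take k D))) \<and>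
    card (open_cols y (A - {c}) D) = card (open_cols y (A - {c}) []) \<and> y + nN D \<le> w c"
proof -
  let ?v = "pop 0 {..<m} s"
  define c where "c = (LEAST c. c < m \<and> ?v c \<noteq> w c)"
  have c: "c < m" "?v c \<noteq> w c" using LeastI_ex[of "\<lambda>c. c < m \<and> ?v c \<noteq> w c"] ne unfolding c_def by auto
  have cl: "?v e = w e" if "e < c" for e
    using not_less_Least[of e "\<lambda>c. c < m \<and> ?v c \<noteq> w c"] that c(1) unfolding c_def by simp
  have vw: "?v c < w c" using c w(2)[OF c(1)] by simp
  obtain X Z where XZ: "s = X @ East # Z" "top_col (rest 0 {..<m} X) (0 + nN X) = c" "?v c = 0 + nN X"
    using pop_split[OF leg _ _ _, of c] fin c(1) by auto
  define y A where "y = nN X" and "A = rest 0 {..<m} X"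
  have tc: "top_col A y = c" and vc: "?v c = y" using XZ by (auto simp: y_def A_def)
  have wc: "h c \<le> y" "y < w c" "w c \<le> n"
    using nested_pop[OF leg fin n] w(1) c(1) vc vw unfolding nested_def by auto
  let ?A = "A - {c}"
  have finA: "finite A" unfolding A_def by (simp add: finite_rest)
  have Am: "A \<subseteq> {..<m}" unfolding A_def by (rule rest_subset)
  have l: "legal 0 {..<m} X" "avail A y \<noteq> {}" "legal y ?A Z"
    using leg unfolding XZ(1) by (simp_all add: legal_append tc flip: A_def y_def)
  have finZ: "rest y ?A Z = {}"
    using fin unfolding XZ(1) by (simp add: rest_append tc flip: A_def y_def)
  have val: "?v e = pop (y + nN (take j Z)) (rest y ?A (take j Z)) (drop j Z) e"
    if e: "e \<in> rest y ?A (take j Z)" for e j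
  proof -
    have s: "s = (X @ [East] @ take j Z) @ drop j Z" unfolding XZ(1) by simp
    have "e \<in> rest 0 {..<m} (X @ [East] @ take j Z)"
      using e by (simp add: rest_append tc flip: A_def y_def)
    then have "?v e = pop (0 + nN (X @ [East] @ take j Z)) (rest 0 {..<m} (X @ [East] @ take j Z)) (drop j Z) e"
      using leg unfolding s by (subst pop_append) auto
    then show ?thesis by (simp add: rest_append tc add.assoc flip: A_def y_def)
  qed
  have legd: "legal (y + nN (take j Z)) (rest y ?A (take j Z)) (drop j Z)"
    and rd: "rest (y + nN (take j Z)) (rest y ?A (take j Z)) (drop j Z) = {}" for j
    using l(3) finZ legal_append[of y ?A "take j Z" "drop j Z"] rest_append[of y ?A "take j Z" "drop j Z"]
    by auto
  \<comment> \<open>An East step would pop some \<open>d < c\<close> at height \<open>y\<close>.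
    Then \<open>w d = y\<close>, and nestedness would force \<open>w c \<le> y\<close>.\<close>
  have Z: "\<exists>Z'. Z = North # Z'"
  proof (cases Z)
    case Nil
    then have "y = n" using n unfolding XZ(1) y_def by simp
    then show ?thesis using wc by simp
  next
    case (Cons a Z')
    show ?thesis
    proof (cases a)
      case North
      then show ?thesis using Cons by simp
    next
      case East
      let ?d = "top_col ?A y"
      have "avail ?A y \<noteq> {}" using l(3) Cons East by simp
      then have d: "?d \<in> avail ?A y" using finA by (intro top_col_in) auto
      then have "?d \<in> avail A y" "?d \<noteq> c" by (auto simp: avail_def)
      then have dc: "?d < c" using top_col_ge[OF finA, of ?d y] tc by simp
      have "?v ?d = y" using val[of ?d 0] d Cons East by (simp add: avail_def)
      then have "w ?d = y" using cl[OF dc] by simp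
      then have "w c \<le> y" using w(1) dc c(1) wc(1) unfolding nested_def by metis
      then show ?thesis using wc by simp
    qed
  qed
  define sz where "sz k = card (open_cols y ?A (take k Z))" for k
  have sz0: "sz 0 = card (open_cols y ?A [])" by (simp add: sz_def)
  have szS: "sz k \<le> Suc (sz (Suc k))" if "k < length Z" for k
    unfolding sz_def take_Suc_conv_app_nth[OF that] using finA by (intro card_open_cols_snoc) auto
  have sz1: "sz 0 \<le> sz 1"
  proof -
    obtain Z' where "Z = North # Z'" using Z by blast
    then have "take 1 Z = [] @ [North]" by simp
    then show ?thesis unfolding sz_def using finA open_cols_snoc_North[of y ?A "[]"]
      by (metis card_mono finite_Diff finite_open_cols take_0)
  qed
  have ex: "0 < length Z \<and> sz (length Z) \<le> sz 0"
    using Z by (auto simp: sz_def open_cols_def finZ avail_def)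
  \<comment> \<open>The first return to the initial size; it exists because the stack is empty at
    the end.\<close>
  define k where "k = (LEAST k. 0 < k \<and> sz k \<le> sz 0)"
  have k: "0 < k" "sz k \<le> sz 0" "k \<le> length Z"
    using LeastI[of "\<lambda>k. 0 < k \<and> sz k \<le> sz 0", OF ex] Least_le[of "\<lambda>k. 0 < k \<and> sz k \<le> sz 0", OF ex]
    unfolding k_def by auto
  have kup: "sz 0 < sz j" if "0 < j" "j < k" for j
    using not_less_Least[of j "\<lambda>k. 0 < k \<and> sz k \<le> sz 0"] that unfolding k_def by auto
  have szk: "sz k = sz 0"
  proof (cases "k = 1")
    case True
    then show ?thesis using sz1 k by simp
  next
    case False
    then have "0 < k - 1" "k - 1 < k" using k by auto
    moreover from this have "k - 1 < length Z" using k by linarith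
    from szS[OF this] have "sz (k - 1) \<le> Suc (sz k)" using k by simp
    ultimately show ?thesis using kup[of "k - 1"] k by linarith
  qed
  \<comment> \<open>Before a further North step from height \<open>?z\<close>, some column
    \<open>e > c\<close> is open. It is popped above \<open>?z\<close>, and nestedness gives
    \<open>w e \<le> w c\<close>.\<close>
  have hgt: "j \<le> k \<Longrightarrow> 0 < j \<Longrightarrow> y + nN (take j Z) \<le> w c" for j
  proof (induction j)
    case (Suc j)
    have jl: "j < length Z" using Suc k by simp
    show ?case
    proof (cases "j = 0")
      case True
      then show ?thesis using Z wc by auto
    next
      case False
      then have IH: "y + nN (take j Z) \<le> w c" and up: "sz 0 < sz j" using Suc kup by auto
      show ?thesis
      proof (cases "Z ! j")
        case East
        then show ?thesis unfolding take_Suc_conv_app_nth[OF jl] using IH by simp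
      next
        case North
        let ?z = "y + nN (take j Z)" and ?R = "rest y ?A (take j Z)"
        have "\<not> open_cols y ?A (take j Z) \<subseteq> open_cols y ?A []"
          using up finA card_mono[of "open_cols y ?A []" "open_cols y ?A (take j Z)"] unfolding sz_def by auto
        then obtain e where e: "e \<in> open_cols y ?A (take j Z)" "e \<notin> open_cols y ?A []" by blast
        then have eR: "e \<in> ?R" "h e \<le> ?z" by (auto simp: open_cols_def avail_def)
        then have eA: "e \<in> A" using rest_subset[of y ?A "take j Z"] by auto
        then have em: "e < m" using Am by auto
        have "y < h e" using e(2) eR rest_subset[of y ?A "take j Z"] by (auto simp: open_cols_def avail_def)
        then have ce: "c < e" using h_mono[of e c] c(1) wc(1) by (cases "c < e") auto
        have "drop j Z = North # drop (Suc j) Z" using Cons_nth_drop_Suc[OF jl] North by simp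
        then have "Suc ?z \<le> ?v e"
          using val[OF eR(1)] legd[of j] rd[of j] eR(1) finA
            pop_bounds[of "Suc ?z" ?R "drop (Suc j) Z" e] by (simp add: finite_rest)
        also have "\<dots> \<le> w e" by (rule w(2)[OF em])
        also have "\<dots> \<le> w c" using w(1) ce em eR(2) IH unfolding nested_def by (meson order_trans)
        finally show ?thesis unfolding take_Suc_conv_app_nth[OF jl] North by simp
      qed
    qed
  qed simp
  let ?D = "take k Z" and ?Y = "drop k Z"
  have "s = X @ [East] @ ?D @ ?Y" unfolding XZ(1) by simp
  moreover have "?D \<noteq> []" "hd ?D = North" using Z k by auto
  moreover have "card (open_cols y ?A []) < card (open_cols y ?A (take j ?D))" if "0 < j" "j < length ?D" for j
  proof -
    have "j < k" using that k(3) by (simp add: min_def split: if_splits)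
    then show ?thesis using kup[OF that(1)] unfolding sz0[symmetric] sz_def by (simp add: min_def)
  qed
  moreover have "card (open_cols y ?A ?D) = card (open_cols y ?A [])" using szk unfolding sz0[symmetric] sz_def .
  moreover have "y + nN ?D \<le> w c" using hgt[of k] k by simp
  ultimately show ?thesis using y_def A_def tc by blast
qed

end

section \<open>Heights of east steps and lattice points\<close>

fun east_heights :: "nat \<Rightarrow> step list \<Rightarrow> nat list" where
  "east_heights y [] = []"
| "east_heights y (North # s) = east_heights (Suc y) s"
| "east_heights y (East # s) = y # east_heights y s"

lemma east_heights_append: "east_heights y (s @ t) = east_heights y s @ east_heights (y + nN s) t"
  by (induction y s rule: east_heights.induct) auto

lemma length_east_heights: "length (east_heights y s) = nE s"
  by (induction y s rule: east_heights.induct) auto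

lemma east_heights_bounds: "a \<in> set (east_heights y s) \<Longrightarrow> y \<le> a \<and> a \<le> y + nN s"
  by (induction y s rule: east_heights.induct) (auto dest: Suc_leD)

lemma sorted_east_heights: "sorted (east_heights y s)"
  by (induction y s rule: east_heights.induct) (auto dest: east_heights_bounds)

lemma lattice_points_snoc: "lattice_points (s @ [a]) = insert (endpoint (s @ [a])) (lattice_points s)"
proof -
  have img: "lattice_points s = (\<lambda>k. endpoint (take k s)) ` {..length s}" for s
    by (auto simp: lattice_points_def)
  have "lattice_points (s @ [a]) = insert (endpoint (s @ [a])) ((\<lambda>k. endpoint (take k (s @ [a]))) ` {..length s})"
    unfolding img by (simp add: atMost_Suc)
  also have "(\<lambda>k. endpoint (take k (s @ [a]))) ` {..length s} = lattice_points s"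
    unfolding img by (intro image_cong) auto
  finally show ?thesis .
qed

text \<open>The path enters height \<open>y\<close> after all east steps below it and leaves after
  those at \<open>y\<close>, so each row is an interval.\<close>

lemma lattice_points_iff:
  "(x, y) \<in> lattice_points s \<longleftrightarrow> y \<le> nN s \<and>
    length (filter (\<lambda>a. a < y) (east_heights 0 s)) \<le> x \<and> x \<le> length (filter (\<lambda>a. a \<le> y) (east_heights 0 s))"
proof (induction s rule: rev_induct)
  case Nil
  then show ?case by (auto simp: lattice_points_def endpoint_def)
next
  case (snoc a s)
  have le: "b \<le> nN s" if "b \<in> set (east_heights 0 s)" for b
    using east_heights_bounds[OF that] by simp
  have full: "length (filter (\<lambda>a. a \<le> z) (east_heights 0 s)) = nE s" if "nN s \<le> z" for z
    using le that by (subst filter_True) (auto simp: length_east_heights intro: order_trans)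
  have fulls: "length (filter (\<lambda>a. a < z) (east_heights 0 s)) = nE s" if "nN s < z" for z
    using le that by (subst filter_True) (auto simp: length_east_heights intro: le_less_trans)
  have lt: "length (filter (\<lambda>a. a < nN s) (east_heights 0 s)) \<le> nE s"
    using length_filter_le[of _ "east_heights 0 s"] by (simp add: length_east_heights)
  show ?case
  proof (cases a)
    case North
    show ?thesis unfolding lattice_points_snoc North insert_iff snoc
      by (cases "y \<le> nN s"; cases "y = Suc (nN s)")
        (auto simp: endpoint_def east_heights_append full fulls)
  next
    case East
    show ?thesis unfolding lattice_points_snoc East insert_iff snoc
      using lt by (cases "y = nN s"; cases "y < nN s") (auto simp: endpoint_def east_heights_append full fulls)
  qed
qed

section \<open>The lattice as the componentwise order on nested vectors\<close>

locale tam =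
  fixes \<nu> :: "step list"
begin

abbreviation "m \<equiv> nE \<nu>"
abbreviation "n \<equiv> nN \<nu>"

sublocale heights m n "\<lambda>c. east_heights 0 \<nu> ! c"
proof
  fix c d assume "c \<le> d" "d < m"
  then show "east_heights 0 \<nu> ! c \<le> east_heights 0 \<nu> ! d"
    by (intro sorted_nth_mono) (auto simp: sorted_east_heights length_east_heights)
next
  fix c assume "c < m"
  then show "east_heights 0 \<nu> ! c \<le> n"
    using east_heights_bounds[of "east_heights 0 \<nu> ! c" 0 \<nu>] by (simp add: length_east_heights)
qed

abbreviation "h c \<equiv> east_heights 0 \<nu> ! c"

lemma card_avail: "card (avail {..<m} y) = length (filter (\<lambda>a. a \<le> y) (east_heights 0 \<nu>))"
  unfolding length_filter_conv_card avail_def length_east_heights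
  by (rule arg_cong[where f = card]) auto

lemma le_card_avail: "(x, y) \<in> lattice_points \<nu> \<Longrightarrow> x \<le> card (avail {..<m} y)"
  by (simp add: card_avail lattice_points_iff)

lemma card_avail_mem: "y \<le> n \<Longrightarrow> (card (avail {..<m} y), y) \<in> lattice_points \<nu>"
proof -
  have "length (filter (\<lambda>a. a < y) (east_heights 0 \<nu>)) \<le> length (filter (\<lambda>a. a \<le> y) (east_heights 0 \<nu>))"
    unfolding length_filter_conv_card by (intro card_mono) auto
  then show "y \<le> n \<Longrightarrow> ?thesis" by (simp add: card_avail lattice_points_iff)
qed

lemma card_avail_mono: "y \<le> z \<Longrightarrow> card (avail {..<m} y) \<le> card (avail {..<m} z)"
  by (intro card_mono) (auto simp: avail_def)

lemma point_above_iff: "y \<le> n \<Longrightarrow> point_above \<nu> (x, y) \<longleftrightarrow> x \<le> card (avail {..<m} y)"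
proof
  assume "point_above \<nu> (x, y)"
  then obtain y' where "y' \<le> y" "(x, y') \<in> lattice_points \<nu>" by (auto simp: point_above_def)
  then show "x \<le> card (avail {..<m} y)" using le_card_avail card_avail_mono order_trans by blast
next
  assume y: "y \<le> n" and x: "x \<le> card (avail {..<m} y)"
  \<comment> \<open>At the least height with \<open>x\<close> columns, fewer than \<open>x\<close>
    lie strictly below unless \<open>z = 0\<close>, so \<open>(x, z)\<close> is on
    \<open>\<nu>\<close>.\<close>
  define z where "z = (LEAST z. x \<le> card (avail {..<m} z))"
  have z: "x \<le> card (avail {..<m} z)" "z \<le> y"
    unfolding z_def using x by (auto intro: LeastI Least_le)
  have "length (filter (\<lambda>a. a < z) (east_heights 0 \<nu>)) \<le> x"
  proof (cases z)
    case (Suc z')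
    then have "\<not> x \<le> card (avail {..<m} z')"
      using not_less_Least[of z' "\<lambda>z. x \<le> card (avail {..<m} z)"] unfolding z_def by simp
    then show ?thesis unfolding card_avail Suc by (simp add: less_Suc_eq_le)
  qed simp
  then have "(x, z) \<in> lattice_points \<nu>" using z y by (simp add: lattice_points_iff card_avail)
  then show "point_above \<nu> (x, y)" using z unfolding point_above_def by auto
qed

lemma horiz_dist_eq: "y \<le> n \<Longrightarrow> x \<le> card (avail {..<m} y) \<Longrightarrow>
  horiz_dist \<nu> (x, y) = card (avail {..<m} y) - x"
  unfolding horiz_dist_def
proof (rule Greatest_equality)
  assume "y \<le> n" "x \<le> card (avail {..<m} y)"
  then show "(fst (x, y) + (card (avail {..<m} y) - x), snd (x, y)) \<in> lattice_points \<nu>"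
    using card_avail_mem by simp
next
  fix d assume "(fst (x, y) + d, snd (x, y)) \<in> lattice_points \<nu>"
  then show "d \<le> card (avail {..<m} y) - x" using le_card_avail[of "x + d" y] by simp
qed

abbreviation "cols \<equiv> {..<m}"

lemma Tam_paths_iff: "\<mu> \<in> Tam_paths \<nu> \<longleftrightarrow> legal 0 cols \<mu> \<and> rest 0 cols \<mu> = {} \<and> nN \<mu> = n"
proof
  assume "\<mu> \<in> Tam_paths \<nu>"
  then have e: "nE \<mu> = m" "nN \<mu> = n" and ab: "\<And>v. v \<in> lattice_points \<mu> \<Longrightarrow> point_above \<nu> v"
    by (auto simp: Tam_paths_def endpoint_def)
  have "legal 0 cols \<mu>"
  proof (rule legalI)
    fix k assume "k \<le> length \<mu>"
    then have "endpoint (take k \<mu>) \<in> lattice_points \<mu>" unfolding lattice_points_def by blast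
    then have "point_above \<nu> (nE (take k \<mu>), nN (take k \<mu>))" using ab by (simp add: endpoint_def)
    moreover have "nN (take k \<mu>) \<le> n"
      using e(2) by (metis append_take_drop_id count_list_append le_add1)
    ultimately show "nE (take k \<mu>) \<le> card (avail cols (0 + nN (take k \<mu>)))"
      by (simp add: point_above_iff)
  qed simp
  moreover from card_rest[OF this] have "card (rest 0 cols \<mu>) = 0" using e by simp
  then have "rest 0 cols \<mu> = {}" using finite_rest[of cols 0 \<mu>] by simp
  ultimately show "legal 0 cols \<mu> \<and> rest 0 cols \<mu> = {} \<and> nN \<mu> = n" using e by simp
next
  assume a: "legal 0 cols \<mu> \<and> rest 0 cols \<mu> = {} \<and> nN \<mu> = n"
  then have "nE \<mu> = m" using card_rest[of 0 cols \<mu>] by simp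
  moreover have "point_above \<nu> v" if v: "v \<in> lattice_points \<mu>" for v
  proof -
    obtain k where k: "v = (nE (take k \<mu>), nN (take k \<mu>))"
      using v by (auto simp: lattice_points_def endpoint_def)
    have "nN (take k \<mu>) \<le> n"
      using a by (metis append_take_drop_id count_list_append le_add1)
    moreover have "nE (take k \<mu>) \<le> card (avail cols (nN (take k \<mu>)))"
      using card_avail_rest[of 0 cols "take k \<mu>" "nN (take k \<mu>)"] a legal_take by force
    ultimately show ?thesis unfolding k by (simp add: point_above_iff)
  qed
  ultimately show "\<mu> \<in> Tam_paths \<nu>" using a by (auto simp: Tam_paths_def endpoint_def)
qed

lemma horiz_dist_endpoint:
  assumes "\<mu> \<in> Tam_paths \<nu>" "\<mu> = s @ t"
  shows "horiz_dist \<nu> (endpoint s) = card (open_cols 0 cols s)"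
proof -
  have l: "legal 0 cols s" "nN s \<le> n" using assms unfolding Tam_paths_iff by (auto simp: legal_append)
  have "card (open_cols 0 cols s) + nE s = card (avail cols (nN s))"
    using card_avail_rest[OF l(1), of "nN s"] by (simp add: open_cols_def)
  then show ?thesis unfolding endpoint_def using l by (subst horiz_dist_eq) auto
qed

definition pop_heights :: "step list \<Rightarrow> nat \<Rightarrow> nat" where
  "pop_heights \<mu> = pop 0 cols \<mu>"

lemma nested_pop_heights: "\<mu> \<in> Tam_paths \<nu> \<Longrightarrow> nested (pop_heights \<mu>)"
  unfolding pop_heights_def Tam_paths_iff by (intro nested_pop) auto

lemma pop_heights_inject: "\<mu> \<in> Tam_paths \<nu> \<Longrightarrow> \<mu>' \<in> Tam_paths \<nu> \<Longrightarrow> pop_heights \<mu> = pop_heights \<mu>' \<Longrightarrow> \<mu> = \<mu>'"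
  unfolding pop_heights_def Tam_paths_iff by (intro pop_inject[of 0 cols \<mu> \<mu>']) auto

lemma pop_heights_surj:
  assumes "nested v"
  shows "\<exists>\<mu>\<in>Tam_paths \<nu>. pop_heights \<mu> = v"
proof -
  obtain s where s: "legal 0 cols s" "rest 0 cols s = {}" "0 + nN s = n" "\<forall>c\<in>cols. pop 0 cols s c = v c"
    using pop_surj[OF assms, of cols 0] by auto
  have "pop 0 cols s c = v c" for c
  proof (cases "c < m")
    case False
    then show ?thesis using pop_outside[OF s(1), of c] assms by (simp add: nested_def)
  qed (use s in simp)
  then show ?thesis using s by (intro bexI[of _ s]) (auto simp: pop_heights_def Tam_paths_iff)
qed

lemma open_cols_append: "open_cols 0 cols (s @ t) = open_cols (nN s) (rest 0 cols s) t"
  by (simp add: open_cols_def rest_append add.assoc)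

lemma open_cols_after_East:
  "open_cols 0 cols (s @ [East] @ t) = open_cols (nN s) (rest 0 cols s - {top_col (rest 0 cols s) (nN s)}) t"
  using open_cols_append[of "s @ [East]" t] by (simp add: rest_append)

lemma Tam_cover_pop_heights:
  assumes "Tam_cover \<nu> \<mu> \<mu>'"
  shows "\<mu>' \<in> Tam_paths \<nu> \<and> (\<exists>c<m. \<exists>z>pop_heights \<mu> c. pop_heights \<mu>' = (pop_heights \<mu>)(c := z))"
proof -
  from assms obtain X D Y where mu: "\<mu> \<in> Tam_paths \<nu>" and eq: "\<mu> = X @ [East] @ D @ Y" "\<mu>' = X @ D @ [East] @ Y"
    and D: "D \<noteq> []" "hd D = North"
    and ret: "horiz_dist \<nu> (endpoint (X @ [East] @ D)) = horiz_dist \<nu> (endpoint (X @ [East]))"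
    and ne: "\<And>k. 0 < k \<Longrightarrow> k < length D \<Longrightarrow>
           horiz_dist \<nu> (endpoint (X @ [East] @ take k D)) \<noteq> horiz_dist \<nu> (endpoint (X @ [East]))"
    unfolding Tam_cover_def by auto
  define y A c where "y = nN X" and "A = rest 0 cols X" and "c = top_col A y"
  define sz where "sz k = card (open_cols y (A - {c}) (take k D))" for k
  have hd': "horiz_dist \<nu> (endpoint (X @ [East] @ take k D)) = sz k" for k
  proof -
    have "\<mu> = (X @ [East] @ take k D) @ drop k D @ Y" unfolding eq by simp
    from horiz_dist_endpoint[OF mu this] show ?thesis
      unfolding open_cols_after_East sz_def c_def y_def A_def .
  qed
  have ret': "sz (length D) = sz 0" using ret hd'[of "length D"] hd'[of 0] by simp
  have ne': "sz k \<noteq> sz 0" if "0 < k" "k < length D" for k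
    using ne[OF that] hd'[of k] hd'[of 0] by simp
  have finA: "finite A" unfolding A_def by (simp add: finite_rest)
  \<comment> \<open>The definition only excludes equality. Starting with North and falling by at
    most one, the size cannot get below its initial value without attaining it.\<close>
  have up: "0 < k \<Longrightarrow> k < length D \<Longrightarrow> sz 0 < sz k" for k
  proof (induction k)
    case (Suc k)
    have kl: "k < length D" using Suc by simp
    show ?case
    proof (cases "k = 0")
      case True
      have "take 1 D = [] @ [North]" using D by (cases D) auto
      then have "sz 0 \<le> sz 1" unfolding sz_def using finA open_cols_snoc_North[of y "A - {c}" "[]"]
        by (metis card_mono finite_Diff finite_open_cols take_0)
      then show ?thesis using ne'[of 1] Suc True by simp
    next
      case False
      then have "sz 0 < sz k" using Suc by simp
      moreover have "sz k \<le> Suc (sz (Suc k))"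
        unfolding sz_def take_Suc_conv_app_nth[OF kl] using finA by (intro card_open_cols_snoc) auto
      ultimately show ?thesis using ne'[of "Suc k"] Suc by simp
    qed
  qed simp
  have nD: "0 < nN D" using D by (cases D) auto
  have "legal 0 cols (X @ D @ [East] @ Y) \<and> rest 0 cols (X @ D @ [East] @ Y) = {} \<and>
    pop 0 cols (X @ D @ [East] @ Y) = (pop 0 cols (X @ [East] @ D @ Y))(c := y + nN D) \<and>
    c < m \<and> pop 0 cols (X @ [East] @ D @ Y) c = y"
  proof (rule cover_move[OF _ _ y_def A_def c_def D])
    show "legal 0 cols (X @ [East] @ D @ Y)" "rest 0 cols (X @ [East] @ D @ Y) = {}"
      using mu unfolding Tam_paths_iff eq by auto
  qed (use up ret' in \<open>auto simp: sz_def\<close>)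
  moreover have "nN \<mu>' = n" using mu unfolding Tam_paths_iff eq by simp
  ultimately show ?thesis using nD unfolding Tam_paths_iff pop_heights_def eq[symmetric]
    by (intro conjI exI[of _ c] exI[of _ "y + nN D"]) auto
qed

lemma Tam_cover_exists:
  assumes mu: "\<mu> \<in> Tam_paths \<nu>" and w: "nested w" "pop_heights \<mu> \<le> w" "pop_heights \<mu> \<noteq> w"
  shows "\<exists>\<mu>'. Tam_cover \<nu> \<mu> \<mu>' \<and> pop_heights \<mu>' \<le> w"
proof -
  have l: "legal 0 cols \<mu>" "rest 0 cols \<mu> = {}" "nN \<mu> = n" using mu unfolding Tam_paths_iff by auto
  obtain c where "pop_heights \<mu> c \<noteq> w c" using w(3) by (auto simp: fun_eq_iff)
  moreover from this have "c < m" using nested_pop_heights[OF mu] w(1) unfolding nested_def by (metis not_le)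
  ultimately have ne: "\<exists>c<m. pop 0 cols \<mu> c \<noteq> w c" unfolding pop_heights_def by blast
  have le: "pop 0 cols \<mu> c \<le> w c" for c using w(2) unfolding pop_heights_def le_fun_def by blast
  obtain X D Y y A c where eq: "\<mu> = X @ [East] @ D @ Y" "y = nN X" "A = rest 0 cols X" "c = top_col A y"
    and D: "D \<noteq> []" "hd D = North"
    and up: "\<And>k. 0 < k \<Longrightarrow> k < length D \<Longrightarrow>
      card (open_cols y (A - {c}) []) < card (open_cols y (A - {c}) (take k D))"
    and ret: "card (open_cols y (A - {c}) D) = card (open_cols y (A - {c}) [])" and wc: "y + nN D \<le> w c"
    using cover_exists[OF l w(1) le ne] by blast
  have hd': "horiz_dist \<nu> (endpoint (X @ [East] @ take k D)) = card (open_cols y (A - {c}) (take k D))" for k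
  proof -
    have "\<mu> = (X @ [East] @ take k D) @ drop k D @ Y" unfolding eq by simp
    from horiz_dist_endpoint[OF mu this] show ?thesis
      unfolding open_cols_after_East eq .
  qed
  have "Tam_cover \<nu> \<mu> (X @ D @ [East] @ Y)"
    unfolding Tam_cover_def
  proof (intro conjI mu exI allI impI)
    show "horiz_dist \<nu> (endpoint (X @ [East] @ D)) = horiz_dist \<nu> (endpoint (X @ [East]))"
      using hd'[of "length D"] hd'[of 0] ret by simp
    show "horiz_dist \<nu> (endpoint (X @ [East] @ take k D)) \<noteq> horiz_dist \<nu> (endpoint (X @ [East]))"
      if "0 < k \<and> k < length D" for k
      using hd'[of k] hd'[of 0] up[of k] that by simp
  qed (use eq(1) D in auto)
  moreover have "pop 0 cols (X @ D @ [East] @ Y) = (pop 0 cols (X @ [East] @ D @ Y))(c := y + nN D)"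
    using cover_move[OF _ _ eq(2-4) D up ret, of Y] l unfolding eq(1) by auto
  then have "pop_heights (X @ D @ [East] @ Y) \<le> w" using le wc unfolding pop_heights_def eq(1)[symmetric] by (auto simp: le_fun_def)
  ultimately show ?thesis by blast
qed

text \<open>For the converse, covers staying below the target exist until it is reached, and each
  reduces the total gap.\<close>

lemma Tam_le_iff:
  assumes "\<mu> \<in> Tam_paths \<nu>" "\<mu>' \<in> Tam_paths \<nu>"
  shows "(Tam_cover \<nu>)\<^sup>*\<^sup>* \<mu> \<mu>' \<longleftrightarrow> pop_heights \<mu> \<le> pop_heights \<mu>'"
proof
  assume "(Tam_cover \<nu>)\<^sup>*\<^sup>* \<mu> \<mu>'"
  then show "pop_heights \<mu> \<le> pop_heights \<mu>'"
  proof (induction rule: rtranclp_induct)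
    case (step y z)
    from Tam_cover_pop_heights[OF step(2)] have "pop_heights y \<le> pop_heights z" by (auto simp: le_fun_def)
    with step.IH show ?case by (rule order_trans)
  qed simp
next
  assume "pop_heights \<mu> \<le> pop_heights \<mu>'"
  with assms show "(Tam_cover \<nu>)\<^sup>*\<^sup>* \<mu> \<mu>'"
  proof (induction "\<Sum>c<m. pop_heights \<mu>' c - pop_heights \<mu> c" arbitrary: \<mu> rule: less_induct)
    case less
    show ?case
    proof (cases "pop_heights \<mu> = pop_heights \<mu>'")
      case True
      then show ?thesis using pop_heights_inject less.prems by auto
    next
      case False
      then obtain \<kappa> where k: "Tam_cover \<nu> \<mu> \<kappa>" "pop_heights \<kappa> \<le> pop_heights \<mu>'"
        using Tam_cover_exists[OF less.prems(1) nested_pop_heights[OF less.prems(2)]] less.prems by blast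
      from Tam_cover_pop_heights[OF k(1)] obtain c z where kt: "\<kappa> \<in> Tam_paths \<nu>" and c: "c < m" "pop_heights \<mu> c < z" "pop_heights \<kappa> = (pop_heights \<mu>)(c := z)"
        by blast
      have "(\<Sum>c<m. pop_heights \<mu>' c - pop_heights \<kappa> c) < (\<Sum>c<m. pop_heights \<mu>' c - pop_heights \<mu> c)"
      proof (rule sum_strict_mono_ex1)
        show "\<forall>d\<in>{..<m}. pop_heights \<mu>' d - pop_heights \<kappa> d \<le> pop_heights \<mu>' d - pop_heights \<mu> d" using c by auto
        have "z \<le> pop_heights \<mu>' c" using k(2) c(3) by (auto simp: le_fun_def split: if_splits)
        then show "\<exists>d\<in>{..<m}. pop_heights \<mu>' d - pop_heights \<kappa> d < pop_heights \<mu>' d - pop_heights \<mu> d" using c by (intro bexI[of _ c]) auto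
      qed simp
      from less.hyps[OF this kt less.prems(2) k(2)] k(1) show ?thesis by (rule converse_rtranclp_into_rtranclp[rotated])
    qed
  qed
qed

end

section \<open>The potential on the spine\<close>

text \<open>Corners account for only some lower covers: the coins are restricted to the image of
  \<open>f\<close> and renamed.\<close>

lemma random_subset_inj:
  fixes f :: "'a \<Rightarrow> 'b"
  assumes "finite L" "inj_on f C" "f ` C \<subseteq> L" "infinite (UNIV :: 'b set)"
  shows "map_pmf (\<lambda>T. {a\<in>C. f a \<in> T}) (random_subset p L) = random_subset p C"
proof -
  have fC: "finite (f ` C)" using assms finite_subset by blast
  \<comment> \<open>Points outside \<open>C\<close> need a value outside the image, so that they
    receive the default coin \<open>False\<close>.\<close>
  obtain z where z: "z \<notin> f ` C" using ex_new_if_finite[OF assms(4) fC] by blast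
  define g where "g x = (if x \<in> C then f x else z)" for x
  have "bij_betw f C (f ` C)" using assms(2) by (simp add: bij_betw_def)
  then have bij: "bij_betw g C (f ` C)" by (subst bij_betw_cong[of _ _ f]) (auto simp: g_def)
  have C: "finite C" using fC assms(2) by (rule finite_imageD)
  have "random_subset p C = map_pmf (\<lambda>F. {a\<in>C. F (g a)}) (Pi_pmf (f ` C) False (\<lambda>_. bernoulli_pmf p))"
    unfolding random_subset_def using z
    by (subst Pi_pmf_bij_betw[OF C bij]) (auto simp: g_def pmf.map_comp o_def)
  also have "\<dots> = map_pmf (\<lambda>T. {a\<in>C. f a \<in> T}) (random_subset p L)"
    unfolding random_subset_def Pi_pmf_subset[OF assms(1,3)] pmf.map_comp using assms(3)
    by (intro pmf.map_cong refl) (auto simp: g_def)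
  finally show ?thesis ..
qed

lemma length_eq_counts: "length s = nE s + nN s"
  by (induction s rule: east_heights.induct[of "\<lambda>_ s. length s = nE s + nN s" 0]) auto

context tam
begin

abbreviation "L \<equiv> Tam \<nu>"

lemma carrier_L [simp]: "carrier L = Tam_paths \<nu>"
  by (simp add: Tam_def)

lemma le_L_iff: "x \<in> Tam_paths \<nu> \<Longrightarrow> y \<in> Tam_paths \<nu> \<Longrightarrow> x \<sqsubseteq>\<^bsub>L\<^esub> y \<longleftrightarrow> pop_heights x \<le> pop_heights y"
  by (simp add: Tam_def Tam_le_iff)

lemma lless_L_iff: "x \<in> Tam_paths \<nu> \<Longrightarrow> y \<in> Tam_paths \<nu> \<Longrightarrow> x \<sqsubset>\<^bsub>L\<^esub> y \<longleftrightarrow> pop_heights x < pop_heights y"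
proof -
  assume xy: "x \<in> Tam_paths \<nu>" "y \<in> Tam_paths \<nu>"
  have "x .=\<^bsub>L\<^esub> y \<longleftrightarrow> x = y" by (simp add: Tam_def)
  also have "\<dots> \<longleftrightarrow> pop_heights x = pop_heights y" using pop_heights_inject[OF xy] by blast
  finally show ?thesis unfolding lless_def le_L_iff[OF xy] less_le by simp
qed

lemma finite_Tam_paths: "finite (Tam_paths \<nu>)"
proof (rule finite_subset)
  have "(UNIV :: step set) = {North, East}" by (auto intro: step.exhaust)
  then have "finite (UNIV :: step set)" by (metis finite.emptyI finite.insertI)
  then show "finite {s :: step list. set s \<subseteq> UNIV \<and> length s = m + n}" by (rule finite_lists_length_eq)
  show "Tam_paths \<nu> \<subseteq> {s. set s \<subseteq> UNIV \<and> length s = m + n}"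
    by (auto simp: Tam_paths_def endpoint_def length_eq_counts)
qed

definition path_of :: "(nat \<Rightarrow> nat) \<Rightarrow> step list" where
  "path_of v = (SOME \<mu>. \<mu> \<in> Tam_paths \<nu> \<and> pop_heights \<mu> = v)"

lemma path_of: "nested v \<Longrightarrow> path_of v \<in> Tam_paths \<nu> \<and> pop_heights (path_of v) = v"
  unfolding path_of_def
  by (rule someI_ex[of "\<lambda>\<mu>. \<mu> \<in> Tam_paths \<nu> \<and> pop_heights \<mu> = v"])
    (use pop_heights_surj[of v] in blast)

text \<open>The vector attaining the minimum at \<open>c\<close> is itself nested, and its value at
  \<open>d\<close> bounds the minimum there.\<close>

lemma nested_Inf:
  assumes A: "A \<noteq> {}" "\<And>v. v \<in> A \<Longrightarrow> nested v"
  shows "nested (\<lambda>c. INF v\<in>A. v c)"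
proof -
  have att: "\<exists>v\<in>A. (INF v\<in>A. v c) = v c" for c :: nat
    using Inf_nat_def1[of "(\<lambda>v. v c) ` A"] A(1) by auto
  have low: "(INF v\<in>A. v c) \<le> v c" if "v \<in> A" for v :: "nat \<Rightarrow> nat" and c
    using that by (intro cINF_lower) auto
  show ?thesis unfolding nested_def
  proof (intro conjI allI impI)
    fix c assume c: "c < m"
    obtain v where "v \<in> A" "(INF v\<in>A. v c) = v c" using att by blast
    then show "h c \<le> (INF v\<in>A. v c)" "(INF v\<in>A. v c) \<le> n" using A(2) c unfolding nested_def by auto
  next
    fix c d assume c: "c < d" "d < m" "h d \<le> (INF v\<in>A. v c)"
    obtain v where v: "v \<in> A" "(INF v\<in>A. v c) = v c" using att by blast
    then have "v d \<le> v c" using A(2) c unfolding nested_def by auto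
    then show "(INF v\<in>A. v d) \<le> (INF v\<in>A. v c)" using low[OF v(1), of d] v(2) by simp
  next
    fix c assume c: "m \<le> c"
    obtain v where "v \<in> A" "(INF v\<in>A. v c) = v c" using att by blast
    then show "(INF v\<in>A. v c) = 0" using A(2) c unfolding nested_def by auto
  qed
qed

text \<open>The meet is a Hilbert choice, so a greatest lower bound must first be exhibited: the
  path of the componentwise minimum.\<close>

lemma inf_L:
  assumes A: "A \<subseteq> Tam_paths \<nu>" "A \<noteq> {}"
  shows "\<Sqinter>\<^bsub>L\<^esub>A \<in> Tam_paths \<nu> \<and> (\<forall>a\<in>A. pop_heights (\<Sqinter>\<^bsub>L\<^esub>A) \<le> pop_heights a)"
proof -
  define w where "w c = (INF v\<in>pop_heights ` A. v c)" for c
  have "nested w" unfolding w_def using A nested_pop_heights by (intro nested_Inf) auto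
  then have g: "path_of w \<in> Tam_paths \<nu>" "pop_heights (path_of w) = w" using path_of by auto
  have "greatest L (path_of w) (Lower L A)"
  proof (rule greatest_LowerI)
    fix x assume "x \<in> A"
    then have "w \<le> pop_heights x" unfolding w_def le_fun_def by (auto intro!: cINF_lower)
    then show "path_of w \<sqsubseteq>\<^bsub>L\<^esub> x" using g A \<open>x \<in> A\<close> by (simp add: le_L_iff subset_iff)
  next
    fix y assume y: "y \<in> Lower L A"
    then have yc: "y \<in> Tam_paths \<nu>" and "\<And>a. a \<in> A \<Longrightarrow> pop_heights y \<le> pop_heights a"
      using A by (auto simp: Lower_def subset_iff le_L_iff)
    then have "pop_heights y \<le> w" unfolding w_def le_fun_def using A(2) by (auto intro!: cINF_greatest)
    then show "y \<sqsubseteq>\<^bsub>L\<^esub> path_of w" using g yc by (simp add: le_L_iff)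
  qed (use A g in auto)
  then have "greatest L (\<Sqinter>\<^bsub>L\<^esub>A) (Lower L A)" unfolding inf_def by (rule someI)
  then have i: "\<Sqinter>\<^bsub>L\<^esub>A \<in> Lower L A" by (rule greatest_mem)
  then have "\<Sqinter>\<^bsub>L\<^esub>A \<in> Tam_paths \<nu>" by (simp add: Lower_def)
  with i A show ?thesis by (auto simp: Lower_def subset_iff le_L_iff)
qed

definition bottom_heights :: "nat \<Rightarrow> nat" where
  "bottom_heights c = (if c < m then h c else 0)"

lemma nested_bottom_heights: "nested bottom_heights"
  unfolding nested_def bottom_heights_def using h_le by auto

lemma pop_heights_bottom: "\<bottom>\<^bsub>L\<^esub> \<in> Tam_paths \<nu> \<and> pop_heights \<bottom>\<^bsub>L\<^esub> = bottom_heights"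
proof -
  have b: "path_of bottom_heights \<in> Tam_paths \<nu>" "pop_heights (path_of bottom_heights) = bottom_heights"
    using path_of[OF nested_bottom_heights] by auto
  have le: "bottom_heights \<le> pop_heights x" if "x \<in> Tam_paths \<nu>" for x
    using nested_pop_heights[OF that] unfolding le_fun_def bottom_heights_def nested_def by auto
  have "least L (path_of bottom_heights) (carrier L)"
    unfolding least_def using b le by (simp add: le_L_iff)
  then have "least L \<bottom>\<^bsub>L\<^esub> (carrier L)" unfolding bottom_def by (rule someI)
  then have "\<bottom>\<^bsub>L\<^esub> \<in> Tam_paths \<nu>" "pop_heights \<bottom>\<^bsub>L\<^esub> \<le> bottom_heights"
    using b unfolding least_def by (auto simp: le_L_iff)
  with le show ?thesis by (auto intro: antisym)
qed

lemma top_in: "\<top>\<^bsub>L\<^esub> \<in> Tam_paths \<nu>"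
proof -
  define t where "t c = (if c < m then n else 0)" for c
  have "nested t" unfolding nested_def t_def using h_le by auto
  then have b: "path_of t \<in> Tam_paths \<nu>" "pop_heights (path_of t) = t" using path_of by auto
  have le: "pop_heights x \<le> t" if "x \<in> Tam_paths \<nu>" for x
    using nested_pop_heights[OF that] unfolding le_fun_def t_def nested_def by auto
  have "greatest L (path_of t) (carrier L)"
    unfolding greatest_def using b le by (simp add: le_L_iff)
  then have "greatest L \<top>\<^bsub>L\<^esub> (carrier L)" unfolding top_def by (rule someI)
  then show ?thesis unfolding greatest_def by simp
qed

text \<open>The order ideals of the cells \<open>(c, y)\<close> with \<open>h c \<le> y < n\<close> index the spine of the lattice;
  \<open>ideal v\<close> is the least such ideal whose spine element lies above \<open>v\<close>.\<close>

definition ideal :: "(nat \<Rightarrow> nat) \<Rightarrow> (nat \<times> nat) set" where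
  "ideal v = {(c, y). c < m \<and> h c \<le> y \<and> (\<exists>d. c \<le> d \<and> d < m \<and> h d < v d \<and> y < v d)}"

text \<open>The maximal cells of \<open>ideal v\<close>: strict right-to-left maxima of
  \<open>v\<close> among the raised columns. A column with \<open>v d = h d\<close> is skipped,
  since its value may be large without contributing a cell.\<close>

definition corners :: "(nat \<Rightarrow> nat) \<Rightarrow> (nat \<times> nat) set" where
  "corners v = {(c, y). c < m \<and> h c < v c \<and> v c = Suc y \<and> (\<forall>d. c < d \<longrightarrow> d < m \<longrightarrow> h d < v d \<longrightarrow> v d < v c)}"

definition lower :: "(nat \<Rightarrow> nat) \<Rightarrow> nat \<times> nat \<Rightarrow> nat \<Rightarrow> nat" where
  "lower v = (\<lambda>(c, y). v(c := y))"

lemma ideal_mono: "v \<le> w \<Longrightarrow> ideal v \<subseteq> ideal w"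
  unfolding ideal_def le_fun_def by (auto intro: less_le_trans)

lemma ideal_subset: "nested v \<Longrightarrow> ideal v \<subseteq> {..<m} \<times> {..<n}"
  unfolding ideal_def nested_def by (auto intro: less_le_trans)

lemma corners_subset: "corners v \<subseteq> ideal v"
  unfolding corners_def ideal_def by auto

lemma ideal_nonempty:
  assumes "nested v" "v \<noteq> bottom_heights"
  shows "ideal v \<noteq> {}"
proof -
  obtain c where c: "v c \<noteq> bottom_heights c" using assms(2) by (auto simp: fun_eq_iff)
  then have "c < m" using assms(1) unfolding nested_def bottom_heights_def by (cases "c < m") auto
  moreover from this have "h c \<le> v c" using assms(1) unfolding nested_def by blast
  ultimately have "c < m" "h c < v c" using c by (auto simp: bottom_heights_def)
  then have "(c, h c) \<in> ideal v" unfolding ideal_def by auto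
  then show ?thesis by blast
qed

lemma corner_above:
  assumes "a \<in> ideal v"
  shows "\<exists>b\<in>corners v. cell_le a b"
proof -
  obtain c y where a: "a = (c, y)" by force
  define P where "P d \<longleftrightarrow> c \<le> d \<and> d < m \<and> h d < v d" for d
  have fin: "finite (Collect P)" by (rule finite_subset[of _ "{..<m}"]) (auto simp: P_def)
  obtain d0 where d0: "P d0" "y < v d0" using assms a unfolding ideal_def P_def by auto
  define M where "M = Max (v ` Collect P)"
  have "M \<in> v ` Collect P" unfolding M_def using d0 fin by (intro Max_in) auto
  then obtain d1 where d1: "P d1" "v d1 = M" by auto
  have M: "v d \<le> M" if "P d" for d unfolding M_def using fin that by (intro Max_ge) auto
  define Q where "Q = {d. P d \<and> v d = M}"
  have finQ: "finite Q" by (rule finite_subset[OF _ fin]) (auto simp: Q_def)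
  have "d1 \<in> Q" using d1 by (simp add: Q_def)
  \<comment> \<open>The last column attaining the maximum, because corners require strict inequality
    to their right.\<close>
  define b where "b = Max Q"
  have b: "P b" "v b = M" using Max_in[OF finQ] \<open>d1 \<in> Q\<close> unfolding b_def Q_def by auto
  have bmax: "d \<le> b" if "P d" "v d = M" for d
    unfolding b_def using finQ that by (intro Max_ge) (auto simp: Q_def)
  have "v d < v b" if "b < d" "d < m" "h d < v d" for d
  proof -
    have "P d" using that b by (auto simp: P_def)
    then show ?thesis using M[of d] bmax[of d] that(1) b(2) by (metis le_neq_implies_less not_le)
  qed
  moreover obtain z where z: "v b = Suc z" using b by (cases "v b") (auto simp: P_def)
  ultimately have "(b, z) \<in> corners v" using b unfolding corners_def P_def by auto
  moreover have "cell_le a (b, z)" using M[OF d0(1)] d0(2) b z unfolding cell_le_def a P_def by auto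
  ultimately show ?thesis by blast
qed

text \<open>Lowering \<open>c\<close> could only put a later column \<open>d\<close> above it. A
  raised \<open>d\<close> already has \<open>v d < v c\<close>, and an unraised one has
  \<open>v d = h d\<close>, within the new bound.\<close>

lemma nested_lower:
  assumes v: "nested v" and a: "a \<in> corners v"
  shows "nested (lower v a)"
proof -
  obtain c y where ac: "a = (c, y)" by force
  have c: "c < m" "h c < v c" "v c = Suc y" "\<And>d. c < d \<Longrightarrow> d < m \<Longrightarrow> h d < v d \<Longrightarrow> v d < v c"
    using a unfolding ac corners_def by auto
  show ?thesis unfolding nested_def ac lower_def prod.case
  proof (intro conjI allI impI)
    fix e assume "e < m"
    then show "h e \<le> (v(c := y)) e" "(v(c := y)) e \<le> n"
      using v c unfolding nested_def by (auto intro: Suc_leD)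
  next
    fix e d assume ed: "e < d" "d < m" "h d \<le> (v(c := y)) e"
    show "(v(c := y)) d \<le> (v(c := y)) e"
    proof (cases "e = c")
      case True
      then have "h d \<le> y" "d \<noteq> c" using ed by auto
      moreover have "v d \<le> y" if "h d < v d" using c(4)[of d] ed True that c(3) by simp
      moreover have "h d \<le> v d" using v ed unfolding nested_def by auto
      ultimately show ?thesis using True by (cases "h d < v d") auto
    next
      case False
      then have "v d \<le> v e" using v ed unfolding nested_def by auto
      then show ?thesis using False c(3) by auto
    qed
  next
    fix e assume "m \<le> e"
    then show "(v(c := y)) e = 0" using v c unfolding nested_def by auto
  qed
qed

text \<open>The cell \<open>(c, y)\<close> could survive only through a raised column with value
  above \<open>y\<close>: column \<open>c\<close> is now too low, and later ones are excluded by the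
  corner condition.\<close>

lemma lower_removes:
  assumes a: "a \<in> corners v" and w: "w \<le> lower v a"
  shows "a \<notin> ideal w"
proof
  obtain c y where ac: "a = (c, y)" by force
  have c: "c < m" "h c < v c" "v c = Suc y" "\<And>d. c < d \<Longrightarrow> d < m \<Longrightarrow> h d < v d \<Longrightarrow> v d < v c"
    using a unfolding ac corners_def by auto
  have wle: "w e \<le> (v(c := y)) e" for e using w unfolding ac lower_def le_fun_def by simp
  assume "a \<in> ideal w"
  then obtain d where d: "c \<le> d" "d < m" "h d < w d" "y < w d" unfolding ideal_def ac by auto
  show False
  proof (cases "d = c")
    case True
    then show False using wle[of c] d by simp
  next
    case False
    then have "w d \<le> v d" using wle[of d] by simp
    then show False using c(4)[of d] d False c(3) by simp
  qed
qed

text \<open>The vectors differ by one in a single coordinate, so none fits between.\<close>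

lemma lower_cover:
  assumes x: "x \<in> Tam_paths \<nu>" and a: "a \<in> corners (pop_heights x)"
  shows "path_of (lower (pop_heights x) a) \<in> lower_covers L x"
proof -
  obtain c y where ac: "a = (c, y)" by force
  have c: "pop_heights x c = Suc y" using a unfolding ac corners_def by auto
  let ?u = "lower (pop_heights x) a"
  have u: "path_of ?u \<in> Tam_paths \<nu>" "pop_heights (path_of ?u) = ?u"
    using path_of[OF nested_lower[OF nested_pop_heights[OF x] a]] by auto
  have lt: "?u < pop_heights x" using c unfolding ac lower_def less_le le_fun_def by (auto simp: fun_eq_iff)
  have "\<not> (?u < w \<and> w < pop_heights x)" for w
  proof
    assume w: "?u < w \<and> w < pop_heights x"
    then have b: "?u e \<le> w e" "w e \<le> pop_heights x e" for e by (auto simp: less_le le_fun_def)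
    have other: "w e = pop_heights x e" if "e \<noteq> c" for e
      using b[of e] that unfolding ac lower_def by simp
    have "w c = y \<or> w c = Suc y" using b[of c] c unfolding ac lower_def by auto
    then have "w = ?u \<or> w = pop_heights x"
    proof
      assume "w c = y"
      then have "w = ?u" using other unfolding ac lower_def by (simp add: fun_eq_iff)
      then show ?thesis ..
    next
      assume wc: "w c = Suc y"
      have "w e = pop_heights x e" for e using other[of e] wc c by (cases "e = c") auto
      then show ?thesis by blast
    qed
    then show False using w by auto
  qed
  then show ?thesis using u x lt unfolding lower_covers_def by (auto simp: lless_L_iff)
qed

lemma inj_on_lower: "x \<in> Tam_paths \<nu> \<Longrightarrow> inj_on (\<lambda>a. path_of (lower (pop_heights x) a)) (corners (pop_heights x))"
proof (rule inj_onI)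
  fix a b assume x: "x \<in> Tam_paths \<nu>" and a: "a \<in> corners (pop_heights x)" and b: "b \<in> corners (pop_heights x)"
    and eq: "path_of (lower (pop_heights x) a) = path_of (lower (pop_heights x) b)"
  obtain c y d z where ab: "a = (c, y)" "b = (d, z)" by force
  have "lower (pop_heights x) a = lower (pop_heights x) b"
    using arg_cong[OF eq, of pop_heights] path_of nested_lower nested_pop_heights[OF x] a b by simp
  from fun_cong[OF this, of c] have "c = d"
    using a b unfolding ab lower_def corners_def by (auto split: if_splits)
  then show "a = b" using a b unfolding ab corners_def by auto
qed

definition potential :: "real \<Rightarrow> step list \<Rightarrow> ennreal" where
  "potential p x = mean_passage_time p ({..<m} \<times> {..<n}) (ideal (pop_heights x))"

lemma set_random_subset: "finite A \<Longrightarrow> T \<in> set_pmf (random_subset p A) \<Longrightarrow> T \<subseteq> A"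
  unfolding random_subset_def by auto

lemma lower_covers_subset: "lower_covers L x \<subseteq> Tam_paths \<nu>"
  unfolding lower_covers_def by auto

text \<open>The meet lies below every chosen cover, so its ideal misses each corner whose cover was
  chosen; monotonicity absorbs the effect of all other choices.\<close>

lemma potential_drift:
  assumes x: "x \<in> Tam_paths \<nu>" "x \<noteq> \<bottom>\<^bsub>L\<^esub>" and p: "p \<in> {0<..1}"
  shows "1 + (\<integral>\<^sup>+z. potential p z \<partial>ungarian_kernel p L x) \<le> potential p x"
proof -
  let ?R = "{..<m} \<times> {..<n}" and ?v = "pop_heights x" and ?LC = "lower_covers L x"
  let ?f = "\<lambda>a. path_of (lower (pop_heights x) a)"
  have fin: "finite ?LC" using lower_covers_subset finite_Tam_paths by (rule finite_subset)
  have v: "nested ?v" using nested_pop_heights x by blast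
  have "?v \<noteq> bottom_heights" using x pop_heights_bottom pop_heights_inject by metis
  then have ne: "ideal ?v \<noteq> {}" using ideal_nonempty v by blast
  have fC: "?f ` corners ?v \<subseteq> ?LC" using lower_cover[OF x(1)] by blast
  have "(\<integral>\<^sup>+z. potential p z \<partial>ungarian_kernel p L x) =
      (\<integral>\<^sup>+T. potential p (\<Sqinter>\<^bsub>L\<^esub>(insert x T)) \<partial>random_subset p ?LC)"
    unfolding ungarian_kernel_def by simp
  also have "\<dots> \<le> (\<integral>\<^sup>+T. mean_passage_time p ?R (ideal ?v - {a\<in>corners ?v. ?f a \<in> T}) \<partial>random_subset p ?LC)"
  proof (rule nn_integral_mono_AE, unfold AE_measure_pmf_iff, rule ballI)
    fix T assume "T \<in> set_pmf (random_subset p ?LC)"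
    then have T: "insert x T \<subseteq> Tam_paths \<nu>"
      using set_random_subset[OF fin] lower_covers_subset x by blast
    let ?z = "\<Sqinter>\<^bsub>L\<^esub>(insert x T)"
    have z: "?z \<in> Tam_paths \<nu>" "\<And>a. a \<in> insert x T \<Longrightarrow> pop_heights ?z \<le> pop_heights a" using inf_L[OF T] by auto
    have "ideal (pop_heights ?z) \<subseteq> ideal ?v" using z(2)[of x] by (intro ideal_mono) auto
    moreover have "a \<notin> ideal (pop_heights ?z)" if a: "a \<in> corners ?v" "?f a \<in> T" for a
    proof (rule lower_removes[OF a(1)])
      have "pop_heights ?z \<le> pop_heights (?f a)" using z(2) a by blast
      then show "pop_heights ?z \<le> lower ?v a" using path_of[OF nested_lower[OF v a(1)]] by simp
    qed
    ultimately have sub: "ideal (pop_heights ?z) \<subseteq> ideal ?v - {a\<in>corners ?v. ?f a \<in> T}" by blast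
    show "potential p ?z \<le> mean_passage_time p ?R (ideal ?v - {a\<in>corners ?v. ?f a \<in> T})"
      unfolding potential_def by (rule mean_passage_time_mono[OF _ _ sub]) (use ideal_subset[OF v] in auto)
  qed
  also have "\<dots> = (\<integral>\<^sup>+S. mean_passage_time p ?R (ideal ?v - S)
      \<partial>map_pmf (\<lambda>T. {a\<in>corners ?v. ?f a \<in> T}) (random_subset p ?LC))"
    by simp
  also have "map_pmf (\<lambda>T. {a\<in>corners ?v. ?f a \<in> T}) (random_subset p ?LC) = random_subset p (corners ?v)"
    by (rule random_subset_inj[OF fin inj_on_lower[OF x(1)] fC]) (rule infinite_UNIV_listI)
  finally have "1 + (\<integral>\<^sup>+z. potential p z \<partial>ungarian_kernel p L x) \<le>
      1 + (\<integral>\<^sup>+S. mean_passage_time p ?R (ideal ?v - S) \<partial>random_subset p (corners ?v))"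
    by (rule add_left_mono)
  also have "\<dots> \<le> potential p x"
    unfolding potential_def
    by (rule mean_passage_time_drift[OF _ ideal_subset[OF v] ne corners_subset corner_above p]) auto
  finally show ?thesis .
qed

lemma ungarian_expected_steps_le:
  fixes p :: real
  assumes p: "0 < p" "p \<le> 1"
  shows "ungarian_expected_steps p L \<le> ennreal ((real m + real n + 2 * sqrt ((1 - p) * real m * real n)) / p)"
proof -
  have "ungarian_expected_steps p L \<le> potential p \<top>\<^bsub>L\<^esub>"
    unfolding ungarian_expected_steps_def
  proof (rule expected_hitting_time_le)
    show "finite (carrier L)" by (simp add: finite_Tam_paths)
    fix x assume x: "x \<in> carrier L"
    have fin: "finite (lower_covers L x)" using lower_covers_subset finite_Tam_paths by (rule finite_subset)
    show "set_pmf (ungarian_kernel p L x) \<subseteq> carrier L"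
    proof
      fix z assume "z \<in> set_pmf (ungarian_kernel p L x)"
      then obtain T where T: "T \<in> set_pmf (random_subset p (lower_covers L x))" "z = \<Sqinter>\<^bsub>L\<^esub>(insert x T)"
        unfolding ungarian_kernel_def by auto
      have "insert x T \<subseteq> Tam_paths \<nu>"
        using set_random_subset[OF fin T(1)] lower_covers_subset x by auto
      from inf_L[OF this] show "z \<in> carrier L" using T(2) by simp
    qed
  next
    fix x assume "x \<in> carrier L" "x \<noteq> \<bottom>\<^bsub>L\<^esub>"
    then show "1 + (\<integral>\<^sup>+z. potential p z \<partial>ungarian_kernel p L x) \<le> potential p x"
      using p by (intro potential_drift) auto
  next
    show "\<top>\<^bsub>L\<^esub> \<in> carrier L" by (simp add: top_in)
  qed
  \<comment> \<open>Passing to the full rectangle leaves a dependence on \<open>\<nu>\<close> only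
    through its step counts.\<close>
  also have "\<dots> \<le> mean_passage_time p ({..<m} \<times> {..<n}) ({..<m} \<times> {..<n})"
    unfolding potential_def using ideal_subset[OF nested_pop_heights[OF top_in]] by (intro mean_passage_time_mono) auto
  also have "\<dots> \<le> ennreal ((real m + real n + 2 * sqrt ((1 - p) * real m * real n)) / p)"
    by (rule mean_passage_time_le[OF p])
  finally show ?thesis .
qed

end

section \<open>From the finite bound to the asymptotics\<close>

theorem theorem1p20:
  fixes p nbar :: real and \<nu> :: "nat \<Rightarrow> step list"
  assumes "0 < p" and "p \<le> 1"
    and "\<And>l. l \<ge> 1 \<Longrightarrow> length (\<nu> l) = l"
    and "(\<lambda>l. real (count_list (\<nu> l) North) / real l) \<longlonglongrightarrow> nbar"
  shows "\<exists>r :: nat \<Rightarrow> real. r \<in> o(\<lambda>l. real l) \<and>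
    (\<forall>l\<ge>1. ungarian_expected_steps p (Tam (\<nu> l)) \<le>
       ennreal ((1 / p) * (1 + 2 * sqrt ((1 - p) * nbar * (1 - nbar))) * real l + r l))"
proof -
  define q where "q l = real (nN (\<nu> l)) / real l" for l
  define b where "b t = (1 / p) * (1 + 2 * sqrt ((1 - p) * t * (1 - t)))" for t
  \<comment> \<open>The exact cost of replacing \<open>q l\<close> by \<open>nbar\<close>; it is
    \<open>o(l)\<close> because \<open>b\<close> is continuous.\<close>
  define r where "r l = (b (q l) - b nbar) * real l" for l
  have "(\<lambda>l. b (q l) - b nbar) \<longlonglongrightarrow> b nbar - b nbar"
    unfolding b_def q_def by (intro tendsto_intros assms(4))
  then have lim: "(\<lambda>l. b (q l) - b nbar) \<longlonglongrightarrow> 0" by simp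
  have "r \<in> o(\<lambda>l. real l)"
  proof (rule smalloI_tendsto)
    show "(\<lambda>l. r l / real l) \<longlonglongrightarrow> 0"
    proof (rule Lim_transform_eventually[OF lim])
      show "\<forall>\<^sub>F l in sequentially. b (q l) - b nbar = r l / real l"
        using eventually_gt_at_top[of 0] by eventually_elim (simp add: r_def)
    qed
    show "\<forall>\<^sub>F l in sequentially. real l \<noteq> 0" using eventually_gt_at_top[of 0] by eventually_elim simp
  qed
  moreover have "ungarian_expected_steps p (Tam (\<nu> l)) \<le> ennreal (b nbar * real l + r l)" if l: "l \<ge> 1" for l
  proof -
    have len: "real (nE (\<nu> l)) + real (nN (\<nu> l)) = real l"
      using assms(3)[OF l] length_eq_counts[of "\<nu> l"] by simp
    have N: "real (nN (\<nu> l)) = q l * l" using l by (simp add: q_def)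
    then have E: "real (nE (\<nu> l)) = (1 - q l) * l" using len by (simp add: left_diff_distrib)
    have "sqrt ((1 - p) * nE (\<nu> l) * nN (\<nu> l)) = sqrt ((1 - p) * q l * (1 - q l) * (l * l))"
      unfolding N E by (simp add: algebra_simps)
    also have "\<dots> = sqrt ((1 - p) * q l * (1 - q l)) * l"
      by (simp add: real_sqrt_mult)
    finally have "(real (nE (\<nu> l)) + real (nN (\<nu> l)) + 2 * sqrt ((1 - p) * nE (\<nu> l) * nN (\<nu> l))) / p = b (q l) * l"
      unfolding len b_def using assms(1) by (simp add: field_simps)
    also have "\<dots> = b nbar * real l + r l" by (simp add: r_def algebra_simps)
    finally show ?thesis
      using tam.ungarian_expected_steps_le[OF assms(1,2), of "\<nu> l"] by simp
  qed
  ultimately show ?thesis unfolding b_def by blast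
qed

end
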